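(* Let $A\subset\mathbb{R}^d$ be a nonempty compact set and $r>0$. Then the following assertions are equivalent: (i) the volume function $V_A$ is differentiable at $r$; (ii) $\mathcal{H}^{d-1}(\partial A_r\setminus\partial^+A_r)=0$; (iii) $\mathcal{H}^{d-1}(\partial A_r\setminus\mathrm{Unp}(A))=0$ and $\mathcal{H}^{d-1}\big((\partial A_r\cap\mathrm{Unp}(A))\setminus\partial^+A_r\big)=0$; (iv) $\mathcal{H}^{d-1}(\partial A_r\setminus\mathrm{Unp}(A))=0$; (v) $\mathcal{H}^{d-1}(\partial A_r\cap\mathrm{crit}(A))=0$.
   Context: For nonempty compact $A\subset\mathbb{R}^d$ and $r>0$, let $A_r:=\{x\in\mathbb{R}^d: d(x,A)<r\}$, where $d(x,A)=\min_{y\in A}|x-y|$, and $V_A(r):=\lambda_d(A_r)$ ($\lambda_d$ Lebesgue measure). $\mathcal{H}^{d-1}$ is $(d-1)$-dimensional Hausdorff measure. $\mathrm{Unp}(A)$ is the set of points $x\in\mathbb{R}^d$ that have a unique nearest point in $A$. The positive boundary $\partial^+Z$ of a set $Z\subset\mathbb{R}^d$ is the set of all boundary points $z\in\partial Z$ for which there exists a point $y\notin\overline{Z}$ with $|y-z|=d(y,Z)$, where $d(y,Z)=\inf_{w\in Z}|y-w|$; $\partial^+A_r$ means $\partial^+(A_r)$. $\mathrm{crit}(A)$ is the set of critical points of the distance function $d(\cdot,A)$: $x\in\mathrm{crit}(A)$ if and only if $x\in\mathrm{conv}\,\Sigma_A(x)$, where $\Sigma_A(x):=\{a\in A:\ |a-x|=d(x,A)\}$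 and $\mathrm{conv}$ denotes the convex hull. *)

theory Defs
  imports "HOL-Analysis.Analysis"
begin

text \<open>
  Integer-dimensional Hausdorff measure, as an outer measure on all subsets of a metric space,
  with the usual normalisation that makes \<open>m\<close>-dimensional measure agree with Lebesgue measure
  on \<open>m\<close>-dimensional Euclidean space. The convention \<open>0 ^ 0 = 1\<close> gives nonempty sets weight \<open>1\<close> for
  \<open>m = 0\<close> (counting measure), whereas the empty set always has weight \<open>0\<close>. Covering sets are
  required to be bounded because \<^const>\<open>diameter\<close> is only meaningful on bounded sets.
\<close>

definition hausdorff_weight :: "nat \<Rightarrow> 'a::metric_space set \<Rightarrow> ennreal" where
  "hausdorff_weight m U =
     (if U = {} then 0 else ennreal (unit_ball_vol (real m) * (diameter U / 2) ^ m))"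

definition hausdorff_premeasure :: "nat \<Rightarrow> real \<Rightarrow> 'a::metric_space set \<Rightarrow> ennreal" where
  "hausdorff_premeasure m \<delta> S =
     (INF U \<in> {U :: nat \<Rightarrow> 'a set. S \<subseteq> (\<Union>i. U i) \<and> (\<forall>i. bounded (U i) \<and> diameter (U i) \<le> \<delta>)}.
        (\<Sum>i. hausdorff_weight m (U i)))"

definition hausdorff_measure :: "nat \<Rightarrow> 'a::metric_space set \<Rightarrow> ennreal" where
  "hausdorff_measure m S = (SUP \<delta> \<in> {0<..}. hausdorff_premeasure m \<delta> S)"

definition parallel_set :: "'a::metric_space set \<Rightarrow> real \<Rightarrow> 'a set" where
  "parallel_set A r = {x. infdist x A < r}"

definition volume_function :: "'a::euclidean_space set \<Rightarrow> real \<Rightarrow> real" where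
  "volume_function A r = measure lebesgue (parallel_set A r)"

definition nearest_points :: "'a::metric_space set \<Rightarrow> 'a \<Rightarrow> 'a set" where
  "nearest_points A x = {a \<in> A. dist a x = infdist x A}"

definition Unp :: "'a::metric_space set \<Rightarrow> 'a set" where
  "Unp A = {x. \<exists>!a. a \<in> nearest_points A x}"

definition positive_boundary :: "'a::metric_space set \<Rightarrow> 'a set" where
  "positive_boundary Z = {z \<in> frontier Z. \<exists>y. y \<notin> closure Z \<and> dist y z = infdist y Z}"

definition crit :: "'a::euclidean_space set \<Rightarrow> 'a set" where
  "crit A = {x. x \<in> convex hull (nearest_points A x)}"

end

theory Submission
  imports Defs
begin

text \<open>
  Let \<open>d\<close> be the distance to \<open>A\<close>. Moving each point towards a chosen nearest point by a fixed factor
  \<open>\<theta> \<le> 1\<close> maps \<open>{d = t}\<close> into \<open>{d = \<theta> t}\<close> and has a \<open>1/\<theta>\<close>-Lipschitz inverse. Comparing adjacent shells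
  by this map shows that the volume function \<open>V\<close> is semiconcave near \<open>r\<close>; hence it is differentiable at
  \<open>r\<close> iff the inner shell \<open>{r - h \<le> d < r}\<close> and the outer shell \<open>{r \<le> d < r + h}\<close> differ in volume
  by \<open>o(h)\<close>.

  If \<open>V\<close> is differentiable, then the part of the inner shell not reached by contracting the outer one has
  volume \<open>o(h)\<close>. It contains the segments of length \<open>h\<close> from the boundary points outside the positive
  boundary towards their nearest points, so these boundary points form a null set by an Eilenberg-type
  inequality. Positive boundary points have a unique nearest point, and critical points do not, which
  gives the chain down to (v).

  Conversely, assume that the critical boundary points form a null set. Near this compact set the inner shell has
  volume at most \<open>e h\<close>. Near a regular boundary point \<open>d\<close> increases in a fixed direction, and since
  \<open>d\<^sup>2 - |x|\<^sup>2\<close> is concave, the inner shell is not wider than the outer one along each line in that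
  direction, up to \<open>o(h)\<close>. Integrating over lines with a partition of unity bounds the inner shell by the
  outer one up to \<open>o(h)\<close>, and semiconcavity provides the opposite bound.
\<close>

section \<open>Expanding maps and sweeps\<close>

text \<open>On \<open>f\<close> T\<open>the map has an\<close>L\<open>-Lipschitz inverse. Disjoint
  balls inside an open superset of\<close>S\<open>cover\<close>f \<open>T\<close> up to a null set,
  and the inverse sends each of them into a ball with radius \<open>L\<close> times as large. The
  factor is exactly \<open>L ^ DIM('a)\<close>, which tends to 1 with \<open>L\<close>;
  semiconcavity of the volume depends on this. Nothing is asked of \<open>f\<close> beyond
  expansion, so it can be built from an arbitrary choice of nearest points.\<close>

lemma emeasure_le_expanding:
  fixes f :: "'a::euclidean_space \<Rightarrow> 'a"
  assumes T: "T \<in> sets borel" and S: "S \<in> sets borel" and L: "0 < L"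
    and fT: "f ` T \<subseteq> S"
    and exp: "\<And>x y. x \<in> T \<Longrightarrow> y \<in> T \<Longrightarrow> dist x y \<le> L * dist (f x) (f y)"
  shows "emeasure lborel T \<le> ennreal (L ^ DIM('a)) * emeasure lborel S"
proof (cases "emeasure lborel S = \<infinity>")
  case True
  then show ?thesis using L by (simp add: ennreal_mult_eq_top_iff)
next
  case fin: False
  have bound: "emeasure lborel T \<le> ennreal (L ^ DIM('a)) * emeasure lborel U"
    if U: "open U" "S \<subseteq> U" for U
  proof -
    define K where "K = {(x, \<rho>). x \<in> f ` T \<and> \<rho> > (0::real) \<and> ball x \<rho> \<subseteq> U}"
    have "\<exists>i\<in>K. x \<in> ball (fst i) (snd i) \<and> snd i < d"
      if x: "x \<in> f ` T" and d: "0 < d" for x d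
    proof -
      from x fT U obtain e where e: "e > 0" "ball x e \<subseteq> U"
        by (metis openE subsetD)
      then have "(x, min e (d/2)) \<in> K" using x d
        by (auto simp: K_def)
      then show ?thesis using e d by (intro bexI[of _ "(x, min e (d/2))"]) auto
    qed
    then have cov: "\<And>x d. x \<in> f ` T \<Longrightarrow> 0 < d \<Longrightarrow> \<exists>i. i \<in> K \<and> x \<in> ball (fst i) (snd i) \<and> snd i < d"
      by blast
    obtain C where C: "countable C" "C \<subseteq> K"
      and disj: "pairwise (\<lambda>i j. disjnt (ball (fst i) (snd i)) (ball (fst j) (snd j))) C"
      and neg: "negligible (f ` T - (\<Union>i\<in>C. ball (fst i) (snd i)))"
      by (rule Vitali_covering_theorem_balls[OF cov])
    obtain c and I :: "nat set" where bij: "bij_betw c I C"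
      using C(1) by (rule countableE_bij)
    have cK: "c i \<in> K" if "i \<in> I" for i
      using bij that C(2) by (auto simp: bij_betw_def)
    define g where "g = inv_into T f"
    have inj: "inj_on f T"
    proof (rule inj_onI)
      fix x y assume "x \<in> T" "y \<in> T" "f x = f y"
      then show "x = y" using exp[of x y] by simp
    qed
    have gf: "g (f x) = x" if "x \<in> T" for x
      using inj that by (simp add: g_def)
    \<comment> \<open>The part missed by the Vitali balls is null, and so is its image under the
      Lipschitz inverse.\<close>
    define N where "N = f ` T - (\<Union>i\<in>C. ball (fst i) (snd i))"
    have gL: "dist (g u) (g w) \<le> L * dist u w" if "u \<in> f ` T" "w \<in> f ` T" for u w
      using that exp gf by auto
    have gN: "negligible (g ` N)"
    proof (rule negligible_locally_Lipschitz_image)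
      show "negligible N" using neg by (simp add: N_def)
      fix x assume "x \<in> N"
      then show "\<exists>V B. open V \<and> x \<in> V \<and> (\<forall>y\<in>N \<inter> V. norm (g y - g x) \<le> B * norm (y - x))"
        using gL[of _ x] unfolding N_def dist_norm by (intro exI[of _ UNIV] exI[of _ L]) auto
    qed simp
    define B where "B = (\<lambda>i. if i \<in> I then ball (fst (c i)) (snd (c i)) else {})"
    define D where "D = (\<lambda>i. if i \<in> I then cball (g (fst (c i))) (L * snd (c i)) else {})"
    have BD: "emeasure lborel (D i) = ennreal (L ^ DIM('a)) * emeasure lborel (B i)" for i
      using cK[of i] L
      by (auto simp: B_def D_def K_def emeasure_ball emeasure_cball power_mult_distrib
          ennreal_mult[symmetric] mult_ac)
    have TD: "T \<subseteq> (\<Union>i. D i) \<union> g ` N"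
    proof
      fix x assume x: "x \<in> T"
      show "x \<in> (\<Union>i. D i) \<union> g ` N"
      proof (cases "f x \<in> N")
        case True
        then show ?thesis using gf[OF x] by (metis UnI2 image_eqI)
      next
        case False
        then obtain k where k: "k \<in> C" "f x \<in> ball (fst k) (snd k)"
          using x by (auto simp: N_def)
        then obtain i where i: "i \<in> I" "k = c i" using bij by (auto simp: bij_betw_def)
        have "dist (g (fst k)) (g (f x)) \<le> L * dist (fst k) (f x)"
          using cK[OF i(1)] i(2) x by (intro gL) (auto simp: K_def)
        also have "\<dots> \<le> L * snd k" using k L by (intro mult_left_mono) auto
        finally have "x \<in> D i" using i gf[OF x] by (simp add: D_def)
        then show ?thesis by auto
      qed
    qed
    have Dm: "D i \<in> sets borel" and Bm: "B i \<in> sets borel" for i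
      by (auto simp: D_def B_def)
    have "emeasure lborel T = emeasure lebesgue T" using T by simp
    also have "\<dots> \<le> emeasure lebesgue ((\<Union>i. D i) \<union> g ` N)"
      using TD gN Dm by (intro emeasure_mono) (auto simp: negligible_imp_sets)
    also have "\<dots> = emeasure lebesgue (\<Union>i. D i)"
    proof (rule emeasure_Un_null_set)
      show "(\<Union>i. D i) \<in> sets lebesgue" using Dm by auto
      show "g ` N \<in> null_sets lebesgue" using gN by (simp add: negligible_iff_null_sets)
    qed
    also have "\<dots> = emeasure lborel (\<Union>i. D i)"
      using Dm by simp
    also have "\<dots> \<le> (\<Sum>i. emeasure lborel (D i))"
      using Dm by (intro emeasure_subadditive_countably) auto
    also have "\<dots> = ennreal (L ^ DIM('a)) * (\<Sum>i. emeasure lborel (B i))"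
      by (simp add: BD ennreal_suminf_cmult)
    also have "(\<Sum>i. emeasure lborel (B i)) = emeasure lborel (\<Union>i. B i)"
    proof (rule suminf_emeasure)
      show "disjoint_family B"
        unfolding disjoint_family_on_def
      proof (intro ballI impI)
        fix m n :: nat assume "m \<noteq> n"
        show "B m \<inter> B n = {}"
        proof (cases "m \<in> I \<and> n \<in> I")
          case True
          then have "c m \<noteq> c n" "c m \<in> C" "c n \<in> C"
            using bij \<open>m \<noteq> n\<close> by (auto simp: bij_betw_def inj_on_def)
          then show ?thesis using disj True by (auto simp: pairwise_def disjnt_def B_def)
        qed (auto simp: B_def)
      qed
    qed (use Bm in auto)
    also have "\<dots> \<le> emeasure lborel U"
      using cK U by (intro emeasure_mono) (force simp: B_def K_def split: if_splits)+
    finally show ?thesis by (simp add: mult_left_mono)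
  qed
  show ?thesis
  proof (rule ennreal_le_epsilon)
    fix e :: real assume e: "0 < e"
    \<comment> \<open>After multiplication by \<open>L ^ DIM('a)\<close> this slack in outer
      regularity becomes exactly \<open>e\<close>.\<close>
    define e' where "e' = e / L ^ DIM('a)"
    have e': "e' > 0" using e L by (simp add: e'_def)
    obtain U where U: "open U" "S \<subseteq> U" "emeasure lborel (U - S) < e'"
      using outer_regular_lborel[OF S e'] .
    have "emeasure lborel U = emeasure lborel S + emeasure lborel (U - S)"
      using U S by (subst plus_emeasure) (auto simp: Un_absorb1)
    also have "\<dots> \<le> emeasure lborel S + e'"
      using U by (intro add_left_mono) auto
    finally have "ennreal (L ^ DIM('a)) * emeasure lborel U
        \<le> ennreal (L ^ DIM('a)) * (emeasure lborel S + e')" by (rule mult_left_mono) simp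
    also have "\<dots> = ennreal (L ^ DIM('a)) * emeasure lborel S + e"
      using L e e' by (simp add: distrib_left ennreal_mult[symmetric] e'_def)
    finally show "emeasure lborel T \<le> ennreal (L ^ DIM('a)) * emeasure lborel S + ennreal e"
      using bound[OF U(1,2)] by simp
  qed
qed

text \<open>
  An Eilenberg-type inequality. Cover \<open>U\<close> by the fivefold enlargements of disjoint balls in \<open>U\<close>; for each
  \<open>t\<close>, pulling back along \<open>e t\<close> the balls that meet the level \<open>c - t\<close> of \<open>D\<close> covers \<open>E\<close>. As \<open>D\<close> is
  1-Lipschitz, a ball of radius \<open>\<rho>\<close> is used only for \<open>t\<close> in an interval of length \<open>10 * \<rho>\<close>, so integrating over
  \<open>t\<close> turns \<open>(d - 1)\<close>-dimensional weights into volumes.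
\<close>

lemma hausdorff_premeasure_le_sweep:
  fixes E :: "'a::euclidean_space set" and e :: "real \<Rightarrow> 'a \<Rightarrow> 'a" and D :: "'a \<Rightarrow> real"
  assumes U: "open U" and h: "0 < h" and \<delta>: "0 < \<delta>"
    and eU: "\<And>t z. 0 < t \<Longrightarrow> t < h \<Longrightarrow> z \<in> E \<Longrightarrow> e t z \<in> U"
    and e_exp: "\<And>t z w. 0 < t \<Longrightarrow> t < h \<Longrightarrow> z \<in> E \<Longrightarrow> w \<in> E \<Longrightarrow> dist z w \<le> 2 * dist (e t z) (e t w)"
    and D_lip: "\<And>x y. \<bar>D x - D y\<bar> \<le> dist x y"
    and D_e: "\<And>t z. 0 < t \<Longrightarrow> t < h \<Longrightarrow> z \<in> E \<Longrightarrow> D (e t z) = c - t"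
  shows "ennreal h * hausdorff_premeasure (DIM('a) - 1) \<delta> E
    \<le> ennreal (unit_ball_vol (real (DIM('a) - 1)) * 10 ^ DIM('a) / unit_ball_vol (DIM('a))) * emeasure lborel U"
proof -
  define d where "d = DIM('a)"
  have d: "d > 0" by (simp add: d_def)
  \<comment> \<open>The fivefold ball has diameter at most \<open>10 * \<rho>\<close> and pulling
    back at most doubles it, so \<open>\<rho> \<le> \<delta> / 20\<close> keeps the pulled back sets
    within diameter \<open>\<delta>\<close>.\<close>
  define K where "K = {(x, \<rho>). 0 < \<rho> \<and> \<rho> \<le> \<delta> / 20 \<and> ball (x::'a) \<rho> \<subseteq> U}"
  have cov: "U \<subseteq> (\<Union>i\<in>K. ball (fst i) (snd i))"
  proof
    fix x assume "x \<in> U"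
    then obtain \<rho> where \<rho>: "\<rho> > 0" "ball x \<rho> \<subseteq> U" using U by (meson openE)
    then have "(x, min \<rho> (\<delta>/20)) \<in> K" using \<delta> by (auto simp: K_def)
    then show "x \<in> (\<Union>i\<in>K. ball (fst i) (snd i))"
      using \<rho> \<delta> by (intro UN_I[of "(x, min \<rho> (\<delta>/20))"]) auto
  qed
  have Kr: "0 < snd i \<and> snd i \<le> \<delta> / 20" if "i \<in> K" for i
    using that by (auto simp: K_def)
  obtain C where C: "countable C" "C \<subseteq> K"
      and disj: "pairwise (\<lambda>i j. disjnt (ball (fst i) (snd i)) (ball (fst j) (snd j))) C"
      and cov5: "U \<subseteq> (\<Union>i\<in>C. ball (fst i) (5 * snd i))"
    by (rule Vitali_covering_lemma_balls[OF cov Kr])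
  obtain k and I :: "nat set" where bij: "bij_betw k I C"
    using C(1) by (rule countableE_bij)
  have kK: "k i \<in> K" if "i \<in> I" for i
    using bij that C(2) by (auto simp: bij_betw_def)
  define B where "B = (\<lambda>i. if i \<in> I then ball (fst (k i)) (snd (k i)) else {})"
  \<comment> \<open>\<open>w i\<close> is the Hausdorff weight belonging to diameter
    \<open>20 * snd (k i)\<close>. \<open>J i\<close> contains all times at which the level
    \<open>c - t\<close> can meet the enlarged ball.\<close>
  define w where "w = (\<lambda>i. if i \<in> I then unit_ball_vol (real (d - 1)) * (10 * snd (k i)) ^ (d - 1) else 0)"
  define J where "J = (\<lambda>i. {c - D (fst (k i)) - 5 * snd (k i) .. c - D (fst (k i)) + 5 * snd (k i)})"
  have w0: "w i \<ge> 0" for i using kK[of i] Kr[of "k i"] by (auto simp: w_def)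
  have P: "hausdorff_premeasure (d - 1) \<delta> E \<le> (\<Sum>i. ennreal (w i) * indicator (J i) t)"
    if t: "0 < t" "t < h" for t
  proof -
    define Q where "Q = (\<lambda>i. if i \<in> I then {z \<in> E. e t z \<in> ball (fst (k i)) (5 * snd (k i))} else {})"
    have Qd: "dist z z' \<le> 20 * snd (k i)" if "z \<in> Q i" "z' \<in> Q i" for z z' i
    proof -
      have zE: "z \<in> E" "z' \<in> E" and z: "dist (fst (k i)) (e t z) < 5 * snd (k i)"
        "dist (fst (k i)) (e t z') < 5 * snd (k i)"
        using that by (auto simp: Q_def split: if_splits)
      have "dist z z' \<le> 2 * dist (e t z) (e t z')" using e_exp t zE by blast
      also have "\<dots> \<le> 2 * (10 * snd (k i))"
        using z dist_triangle2[of "e t z" "e t z'" "fst (k i)"] by (simp add: dist_commute)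
      finally show ?thesis by simp
    qed
    have Qb: "bounded (Q i)" for i
      unfolding bounded_def using Qd by blast
    have Qdia: "diameter (Q i) \<le> 20 * snd (k i)" if "i \<in> I" for i
      using Qd[of _ i] Kr[OF kK[OF that]] by (intro diameter_le) (auto simp: dist_norm)
    have "hausdorff_premeasure (d - 1) \<delta> E \<le> (\<Sum>i. hausdorff_weight (d - 1) (Q i))"
      unfolding hausdorff_premeasure_def
    proof (rule INF_lower, intro CollectI conjI allI)
      show "E \<subseteq> (\<Union>i. Q i)"
      proof
        fix z assume z: "z \<in> E"
        then have "e t z \<in> U" using eU t by blast
        then obtain j where j: "j \<in> C" "e t z \<in> ball (fst j) (5 * snd j)" using cov5 by auto
        then obtain i where "i \<in> I" "j = k i" using bij by (auto simp: bij_betw_def)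
        then have "z \<in> Q i" using z j by (auto simp: Q_def)
        then show "z \<in> (\<Union>i. Q i)" by auto
      qed
      fix i show "bounded (Q i)" by (rule Qb)
      show "diameter (Q i) \<le> \<delta>"
        using Qdia[of i] Kr[OF kK[of i]] \<delta> by (cases "i \<in> I") (auto simp: Q_def)
    qed
    also have "\<dots> \<le> (\<Sum>i. ennreal (w i) * indicator (J i) t)"
    proof (intro suminf_le summableI)
      fix i
      show "hausdorff_weight (d - 1) (Q i) \<le> ennreal (w i) * indicator (J i) t"
      proof (cases "Q i = {}")
        case False
        then obtain z where z: "z \<in> Q i" by auto
        then have i: "i \<in> I" and zE: "z \<in> E" and zb: "dist (fst (k i)) (e t z) < 5 * snd (k i)"
          by (auto simp: Q_def split: if_splits)
        have "\<bar>c - t - D (fst (k i))\<bar> \<le> 5 * snd (k i)"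
          using D_e[OF t zE] D_lip[of "e t z" "fst (k i)"] zb by (simp add: dist_commute)
        then have "t \<in> J i" by (auto simp: J_def)
        moreover have "(diameter (Q i) / 2) ^ (d - 1) \<le> (10 * snd (k i)) ^ (d - 1)"
          using Qdia[OF i] diameter_ge_0[OF Qb[of i]] by (intro power_mono) auto
        ultimately show ?thesis using False i
          by (auto simp: hausdorff_weight_def w_def intro!: ennreal_leI mult_left_mono)
      qed (simp add: hausdorff_weight_def)
    qed
    finally show ?thesis .
  qed
  \<comment> \<open>The premeasure of \<open>E\<close> is constant in \<open>t\<close>, so its
    product with \<open>h\<close> is an integral over \<open>(0, h)\<close>, where the bound
    \<open>P\<close> applies.\<close>
  have "ennreal h * hausdorff_premeasure (d - 1) \<delta> E
      = (\<integral>\<^sup>+t. hausdorff_premeasure (d - 1) \<delta> E * indicator {0<..<h} t \<partial>lborel)"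
    using h by (subst nn_integral_cmult_indicator) (auto simp: mult.commute)
  also have "\<dots> \<le> (\<integral>\<^sup>+t. (\<Sum>i. ennreal (w i) * indicator (J i) t) \<partial>lborel)"
    using P by (intro nn_integral_mono) (auto simp: indicator_def)
  also have "\<dots> = (\<Sum>i. \<integral>\<^sup>+t. ennreal (w i) * indicator (J i) t \<partial>lborel)"
    by (rule nn_integral_suminf) (auto simp: J_def)
  also have "\<dots> = (\<Sum>i. ennreal (unit_ball_vol (real (d - 1)) * 10 ^ d / unit_ball_vol d)
                       * emeasure lborel (B i))"
  proof (rule suminf_cong)
    fix i
    show "(\<integral>\<^sup>+t. ennreal (w i) * indicator (J i) t \<partial>lborel)
      = ennreal (unit_ball_vol (real (d - 1)) * 10 ^ d / unit_ball_vol d) * emeasure lborel (B i)"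
    proof (cases "i \<in> I")
      case True
      then have pos: "0 < snd (k i)" using Kr kK by blast
      define s where "s = snd (k i)"
      have s: "s > 0" using pos by (simp add: s_def)
      have ub: "unit_ball_vol (real d) > 0" by simp
      have "10 * s * (10 * s) ^ (d - 1) = (10 * s) ^ d"
        using d by (cases d) auto
      then have *: "(10 * s) ^ (d - 1) * (10 * s) = 10 ^ d * s ^ d"
        by (simp add: power_mult_distrib mult_ac)
      have "(\<integral>\<^sup>+t. ennreal (w i) * indicator (J i) t \<partial>lborel) = ennreal (w i) * ennreal (10 * s)"
        using s by (subst nn_integral_cmult_indicator) (auto simp: J_def s_def)
      also have "\<dots> = ennreal (unit_ball_vol (real (d - 1)) * ((10 * s) ^ (d - 1) * (10 * s)))"
        using w0[of i] True s by (subst ennreal_mult[symmetric]) (auto simp: w_def s_def mult_ac)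
      also have "\<dots> = ennreal (unit_ball_vol (real (d - 1)) * 10 ^ d / unit_ball_vol d * (unit_ball_vol d * s ^ d))"
        unfolding * using ub by (simp add: field_simps del: unit_ball_vol_pos)
      also have "\<dots> = ennreal (unit_ball_vol (real (d - 1)) * 10 ^ d / unit_ball_vol d) * emeasure lborel (B i)"
        using s True by (subst ennreal_mult) (auto simp: B_def emeasure_ball s_def d_def)
      finally show ?thesis .
    qed (simp add: B_def w_def)
  qed
  also have "\<dots> = ennreal (unit_ball_vol (real (d - 1)) * 10 ^ d / unit_ball_vol d) * (\<Sum>i. emeasure lborel (B i))"
    by simp
  also have "(\<Sum>i. emeasure lborel (B i)) = emeasure lborel (\<Union>i. B i)"
  proof (rule suminf_emeasure)
    show "disjoint_family B"
      unfolding disjoint_family_on_def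
    proof (intro ballI impI)
      fix m n :: nat assume "m \<noteq> n"
      show "B m \<inter> B n = {}"
      proof (cases "m \<in> I \<and> n \<in> I")
        case True
        then have "k m \<noteq> k n" "k m \<in> C" "k n \<in> C"
          using bij \<open>m \<noteq> n\<close> by (auto simp: bij_betw_def inj_on_def)
        then show ?thesis using disj True by (auto simp: pairwise_def disjnt_def B_def)
      qed (auto simp: B_def)
    qed
  qed (auto simp: B_def)
  also have "ennreal (unit_ball_vol (real (d - 1)) * 10 ^ d / unit_ball_vol d) * emeasure lborel (\<Union>i. B i)
    \<le> ennreal (unit_ball_vol (real (d - 1)) * 10 ^ d / unit_ball_vol d) * emeasure lborel U"
    using kK U by (intro mult_left_mono emeasure_mono) (force simp: B_def K_def split: if_splits)+
  finally show ?thesis by (simp add: d_def)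
qed

section \<open>Semiconcave functions of one variable\<close>

text \<open>Subtract the chord. If the difference had a negative minimum, its leftmost minimiser
  \<open>c\<close> would be interior, and midpoint concavity on a symmetric interval around
  \<open>c\<close> would make \<open>c - h\<close> a minimiser as well. The conclusion is the
  concavity inequality without division.\<close>

lemma concave_if_midpoint_concave:
  fixes W :: "real \<Rightarrow> real"
  assumes cont: "continuous_on {x..z} W" and xy: "x < y" "y < z"
    and mid: "\<And>t h. 0 < h \<Longrightarrow> x \<le> t - h \<Longrightarrow> t + h \<le> z \<Longrightarrow> W (t + h) + W (t - h) \<le> 2 * W t"
  shows "(z - y) * W x + (y - x) * W z \<le> (z - x) * W y"
proof -
  define s where "s = (W z - W x) / (z - x)"
  define g where "g t = W t - W x - s * (t - x)" for t
  have contg: "continuous_on {x..z} g"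
    unfolding g_def using cont by (intro continuous_intros)
  have gx: "g x = 0" and gz: "g z = 0" using xy by (auto simp: g_def s_def)
  have gmid: "g (t + h) + g (t - h) \<le> 2 * g t" if "0 < h" "x \<le> t - h" "t + h \<le> z" for t h
    using mid[OF that] by (simp add: g_def algebra_simps)
  obtain m where m: "m \<in> {x..z}" "\<And>t. t \<in> {x..z} \<Longrightarrow> g m \<le> g t"
    using continuous_attains_inf[OF _ _ contg] xy by auto
  have "0 \<le> g m"
  proof (rule ccontr)
    assume neg: "\<not> 0 \<le> g m"
    define M where "M = {t \<in> {x..z}. g t = g m}"
    have "M = {x..z} \<inter> g -` {g m}" by (auto simp: M_def)
    then have "closed M" using continuous_on_closed_vimage[of "{x..z}" g] contg
      by (metis closed_real_atLeastAtMost closed_singleton Int_commute)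
    moreover have "bounded M" by (rule bounded_subset[of "{x..z}"]) (auto simp: M_def)
    ultimately have "compact M" by (simp add: compact_eq_bounded_closed)
    moreover have "M \<noteq> {}" using m by (auto simp: M_def)
    ultimately obtain c where c: "c \<in> M" "\<And>t. t \<in> M \<Longrightarrow> c \<le> t"
      using compact_attains_inf[of M] by auto
    have cx: "x < c" "c < z" using c(1) gx gz neg by (auto simp: M_def less_le)
    define h where "h = min (c - x) (z - c)"
    have h: "h > 0" "x \<le> c - h" "c + h \<le> z" using cx by (auto simp: h_def)
    have "g (c - h) = g m"
      using gmid[OF h] m(2)[of "c - h"] m(2)[of "c + h"] h c(1) by (auto simp: M_def)
    then have "c \<le> c - h" using c(2)[of "c - h"] h by (auto simp: M_def)
    then show False using h by simp
  qed
  then have "0 \<le> g y" using m(2)[of y] xy by auto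
  then have "0 \<le> (z - x) * g y" using xy by simp
  also have "(z - x) * g y = (z - x) * (W y - W x) - (W z - W x) * (y - x)"
    using xy by (simp add: g_def s_def field_simps)
  finally show ?thesis by (simp add: algebra_simps)
qed

text \<open>The quotient is the right difference quotient minus the left one, and both tend to the
  derivative.\<close>

lemma second_difference_tendsto_0:
  fixes V :: "real \<Rightarrow> real"
  assumes "V differentiable (at r)"
  shows "((\<lambda>h. (V (r + h) + V (r - h) - 2 * V r) / h) \<longlongrightarrow> 0) (at_right 0)"
proof -
  obtain D where D: "(V has_real_derivative D) (at r)"
    using assms by (auto simp: real_differentiable_def)
  have r: "((\<lambda>h. (V (r + h) - V r) / h) \<longlongrightarrow> D) (at_right 0)"
    using D by (auto simp: DERIV_def filterlim_at_split)
  have "((\<lambda>h. (V (r + h) - V r) / h) \<longlongrightarrow> D) (at_left 0)"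
    using D by (auto simp: DERIV_def filterlim_at_split)
  then have "((\<lambda>h. (V (r - h) - V r) / (- h)) \<longlongrightarrow> D) (at_right 0)"
    by (subst (asm) filterlim_at_left_to_right) simp
  from tendsto_diff[OF r this] show ?thesis
    by (simp add: field_simps flip: add_divide_distrib diff_divide_distrib)
qed

text \<open>Subtracting \<open>C / 2 * (t - r)\<^sup>2\<close> makes \<open>V\<close> concave. Then
  the right quotients \<open>q\<close> and the left quotients \<open>p\<close> are monotone in
  \<open>h\<close> with \<open>q\<close> below \<open>p\<close>, and the limit hypothesis closes the
  gap between them.\<close>

lemma differentiable_if_second_difference:
  fixes V :: "real \<Rightarrow> real"
  assumes \<delta>: "0 < \<delta>" and cont: "continuous_on {r-\<delta>..r+\<delta>} V"
    and semi: "\<And>t h. 0 < h \<Longrightarrow> r - \<delta> \<le> t - h \<Longrightarrow> t + h \<le> r + \<delta> \<Longrightarrow> V (t + h) + V (t - h) - 2 * V t \<le> C * h\<^sup>2"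
    and lim: "((\<lambda>h. (V (r + h) + V (r - h) - 2 * V r) / h) \<longlongrightarrow> 0) (at_right 0)"
  shows "V differentiable (at r)"
proof -
  define W where "W t = V t - C / 2 * (t - r)\<^sup>2" for t
  have contW: "continuous_on {r-\<delta>..r+\<delta>} W"
    unfolding W_def using cont by (intro continuous_intros)
  have mid: "W (t + h) + W (t - h) \<le> 2 * W t" if "0 < h" "r - \<delta> \<le> t - h" "t + h \<le> r + \<delta>" for t h
    using semi[OF that] by (simp add: W_def power2_eq_square algebra_simps)
  have conc: "(z - y) * W x + (y - x) * W z \<le> (z - x) * W y"
    if "r - \<delta> \<le> x" "x < y" "y < z" "z \<le> r + \<delta>" for x y z
    using that by (intro concave_if_midpoint_concave mid continuous_on_subset[OF contW]) auto
  define q where "q h = (W (r + h) - W r) / h" for h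
  define p where "p h = (W r - W (r - h)) / h" for h
  have q_anti: "q k \<le> q h" if "0 < h" "h \<le> k" "k \<le> \<delta>" for h k
  proof (cases "h = k")
    case False
    then have "(k - h) * W r + h * W (r + k) \<le> k * W (r + h)"
      using conc[of r "r + h" "r + k"] that \<delta> by simp
    then show ?thesis using that by (simp add: q_def field_simps)
  qed simp
  have p_mono: "p h \<le> p k" if "0 < h" "h \<le> k" "k \<le> \<delta>" for h k
  proof (cases "h = k")
    case False
    then have "h * W (r - k) + (k - h) * W r \<le> k * W (r - h)"
      using conc[of "r - k" "r - h" r] that \<delta> by simp
    then show ?thesis using that by (simp add: p_def field_simps)
  qed simp
  have qp: "q h \<le> p k" if "0 < h" "h \<le> \<delta>" "0 < k" "k \<le> \<delta>" for h k
  proof -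
    define l where "l = min h k"
    have l: "0 < l" "l \<le> h" "l \<le> k" using that by (auto simp: l_def)
    have "q l \<le> p l" using mid[of l r] l that by (simp add: q_def p_def divide_right_mono)
    then show ?thesis using q_anti[of l h] p_mono[of l k] l that by linarith
  qed
  \<comment> \<open>\<open>L\<close> separates all right quotients from all left ones, so
    \<open>p h - q h\<close> bounds the distance of both to \<open>L\<close>.\<close>
  define L where "L = Sup (q ` {0<..\<delta>})"
  have qL: "q h \<le> L" if "0 < h" "h \<le> \<delta>" for h
    unfolding L_def using that qp[of _ \<delta>] \<delta> by (intro cSup_upper bdd_aboveI[of _ "p \<delta>"]) auto
  have Lp: "L \<le> p h" if "0 < h" "h \<le> \<delta>" for h
    unfolding L_def using that qp[of _ h] \<delta> by (intro cSup_least) auto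
  have diff: "p h - q h = C * h - (V (r + h) + V (r - h) - 2 * V r) / h" if "0 < h" for h
    using that by (simp add: p_def q_def W_def field_simps power2_eq_square)
  have "((\<lambda>h. C * h - (V (r + h) + V (r - h) - 2 * V r) / h) \<longlongrightarrow> C * 0 - 0) (at_right 0)"
    by (intro tendsto_intros lim)
  then have pq0: "((\<lambda>h. p h - q h) \<longlongrightarrow> 0) (at_right 0)"
    by (rule Lim_transform_eventually[where g = "\<lambda>h. p h - q h", THEN tendsto_eq_rhs])
      (auto simp: diff eventually_at_filter)
  have ev: "eventually (\<lambda>h. 0 < h \<and> h \<le> \<delta>) (at_right (0::real))"
    using eventually_at_right_real[OF \<delta>] by eventually_elim auto
  have q_lim: "(q \<longlongrightarrow> L) (at_right 0)"
  proof (rule Lim_null_comparison[THEN Lim_null[THEN iffD2]])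
    show "eventually (\<lambda>h. norm (q h - L) \<le> p h - q h) (at_right 0)"
      using ev by eventually_elim (use qL Lp in \<open>simp add: abs_le_iff add_increasing2\<close>)
  qed (rule pq0)
  have p_lim: "(p \<longlongrightarrow> L) (at_right 0)"
  proof (rule Lim_null_comparison[THEN Lim_null[THEN iffD2]])
    show "eventually (\<lambda>h. norm (p h - L) \<le> p h - q h) (at_right 0)"
      using ev by eventually_elim (use qL Lp in \<open>simp add: abs_le_iff add_increasing2\<close>)
  qed (rule pq0)
  have "((\<lambda>h. (W (r + h) - W r) / h) \<longlongrightarrow> L) (at 0)"
    unfolding filterlim_at_split
  proof
    show "((\<lambda>h. (W (r + h) - W r) / h) \<longlongrightarrow> L) (at_right 0)"
      using q_lim by (simp add: q_def[abs_def])
    have "(\<lambda>h. (W (r + - h) - W r) / - h) = p"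
      by (auto simp: p_def fun_eq_iff minus_divide_left)
    then show "((\<lambda>h. (W (r + h) - W r) / h) \<longlongrightarrow> L) (at_left 0)"
      using p_lim by (subst filterlim_at_left_to_right) simp
  qed
  then have "(W has_real_derivative L) (at r)" by (simp add: DERIV_def)
  then have "((\<lambda>t. W t + C / 2 * (t - r)\<^sup>2) has_real_derivative (L + 0)) (at r)"
    by (auto intro!: derivative_eq_intros)
  then show ?thesis by (auto simp: W_def[abs_def] real_differentiable_def)
qed

section \<open>Contraction towards nearest points\<close>

text \<open>A selection by choice, possibly discontinuous; only its monotonicity is used to control
  how it varies.\<close>

definition proj :: "'a::metric_space set \<Rightarrow> 'a \<Rightarrow> 'a" where
  "proj A x = (SOME a. a \<in> nearest_points A x)"

definition contract :: "'a::euclidean_space set \<Rightarrow> real \<Rightarrow> 'a \<Rightarrow> 'a" where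
  "contract A \<theta> x = proj A x + \<theta> *\<^sub>R (x - proj A x)"

text \<open>Half-open, so that adjacent shells are disjoint and volume increments are exactly
  volumes of shells.\<close>

definition shell :: "'a::metric_space set \<Rightarrow> real \<Rightarrow> real \<Rightarrow> 'a set" where
  "shell A a b = {x. a \<le> infdist x A \<and> infdist x A < b}"

lemma nearest_pointsD: "a \<in> nearest_points A x \<Longrightarrow> a \<in> A" "a \<in> nearest_points A x \<Longrightarrow> dist x a = infdist x A"
  by (auto simp: nearest_points_def dist_commute)

lemma shell_borel [measurable]: "shell A a b \<in> sets borel"
proof -
  have "shell A a b = {x. a \<le> infdist x A} \<inter> {x. infdist x A < b}" by (auto simp: shell_def)
  moreover have "closed {x. a \<le> infdist x A}" "open {x. infdist x A < b}"
    by (intro closed_Collect_le open_Collect_less continuous_intros)+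
  ultimately show ?thesis by (metis borel_closed borel_open sets.Int)
qed

lemma open_parallel_set: "open (parallel_set A r)"
  unfolding parallel_set_def by (intro open_Collect_less continuous_intros)

lemma bounded_parallel_set:
  fixes A :: "'a::metric_space set"
  assumes "bounded A" "A \<noteq> {}"
  shows "bounded (parallel_set A r)"
proof -
  obtain c B where B: "\<And>a. a \<in> A \<Longrightarrow> dist c a \<le> B" using assms by (auto simp: bounded_def)
  have "dist c x \<le> r + B" if "infdist x A < r" for x
  proof -
    have "bdd_below (dist x ` A)" by (rule bdd_belowI2[of _ 0]) simp
    then have "\<exists>a\<in>A. dist x a < r"
      using that assms(2) by (subst (asm) infdist_notempty) (auto simp: cINF_less_iff)
    then obtain a where a: "a \<in> A" "dist x a < r" by blast
    show ?thesis using dist_triangle2[of c x a] B[OF a(1)] a(2) by simp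
  qed
  then show ?thesis by (auto simp: bounded_def parallel_set_def)
qed

lemma shell_subset_parallel_set: "b \<le> c \<Longrightarrow> shell A a b \<subseteq> parallel_set A c"
  by (auto simp: shell_def parallel_set_def)

context
  fixes A :: "'a::euclidean_space set"
  assumes compact: "compact A" and nonempty: "A \<noteq> {}"
begin

lemma proj_nearest: "proj A x \<in> nearest_points A x"
proof -
  obtain a where "a \<in> A" "infdist x A = dist x a"
    using infdist_attains_inf[of A x] compact nonempty by (auto simp: compact_imp_closed)
  then have "\<exists>a. a \<in> nearest_points A x" by (auto simp: nearest_points_def dist_commute)
  then show ?thesis unfolding proj_def by (rule someI_ex)
qed

lemma proj_in: "proj A x \<in> A" and dist_proj: "dist x (proj A x) = infdist x A"
  using proj_nearest nearest_pointsD by blast+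

text \<open>Add the two inequalities saying that neither point is closer to the other's projection
  than to its own.\<close>

lemma proj_monotone: "0 \<le> (proj A x - proj A y) \<bullet> (x - y)"
proof -
  have "(dist x (proj A x))\<^sup>2 \<le> (dist x (proj A y))\<^sup>2" "(dist y (proj A y))\<^sup>2 \<le> (dist y (proj A x))\<^sup>2"
    by (auto intro!: power_mono simp: dist_proj infdist_le infdist_nonneg proj_in)
  then show ?thesis
    by (simp add: dist_norm power2_norm_eq_inner inner_diff_left inner_diff_right inner_commute)
qed

text \<open>The contracted point is within \<open>\<theta> * infdist x A\<close> of the projection
  of \<open>x\<close>. It cannot be closer to \<open>A\<close>, since it has moved only by
  \<open>(1 - \<theta>) * infdist x A\<close>.\<close>

lemma infdist_contract:
  assumes "0 \<le> \<theta>" "\<theta> \<le> 1"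
  shows "infdist (contract A \<theta> x) A = \<theta> * infdist x A"
    and "dist x (contract A \<theta> x) = (1 - \<theta>) * infdist x A"
proof -
  have 1: "dist (contract A \<theta> x) (proj A x) = \<theta> * infdist x A"
    using assms by (simp add: contract_def dist_norm flip: dist_proj)
  have "x - contract A \<theta> x = (1 - \<theta>) *\<^sub>R (x - proj A x)"
    by (simp add: contract_def algebra_simps)
  then show 2: "dist x (contract A \<theta> x) = (1 - \<theta>) * infdist x A"
    using assms by (simp add: dist_norm flip: dist_proj)
  have "infdist (contract A \<theta> x) A \<le> \<theta> * infdist x A"
    using infdist_le[OF proj_in, of "contract A \<theta> x" x] 1 by simp
  moreover have "infdist x A \<le> infdist (contract A \<theta> x) A + (1 - \<theta>) * infdist x A"
    using infdist_triangle[of x A "contract A \<theta> x"] 2 by simp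
  ultimately show "infdist (contract A \<theta> x) A = \<theta> * infdist x A"
    by (simp add: algebra_simps)
qed

text \<open>The difference of the images is
  \<open>\<theta> *\<^sub>R u + (1 - \<theta>) *\<^sub>R w\<close>. In its squared norm the mixed
  term is nonnegative by monotonicity of the projection.\<close>

lemma dist_contract_ge:
  assumes "0 \<le> \<theta>" "\<theta> \<le> 1"
  shows "\<theta> * dist x y \<le> dist (contract A \<theta> x) (contract A \<theta> y)"
proof -
  define u where "u = x - y"
  define w where "w = proj A x - proj A y"
  have "contract A \<theta> x - contract A \<theta> y = \<theta> *\<^sub>R u + (1 - \<theta>) *\<^sub>R w"
    by (simp add: contract_def u_def w_def algebra_simps)
  moreover have "(norm (\<theta> *\<^sub>R u + (1 - \<theta>) *\<^sub>R w))\<^sup>2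
      = (\<theta> * norm u)\<^sup>2 + 2 * \<theta> * (1 - \<theta>) * (w \<bullet> u) + ((1 - \<theta>) * norm w)\<^sup>2"
    by (simp add: power2_norm_eq_inner power_mult_distrib inner_add_left inner_add_right inner_commute)
      (simp add: power2_eq_square algebra_simps)
  moreover have "0 \<le> 2 * \<theta> * (1 - \<theta>) * (w \<bullet> u)"
    using assms proj_monotone[of x y] by (intro mult_nonneg_nonneg) (auto simp: u_def w_def)
  ultimately have "(\<theta> * dist x y)\<^sup>2 \<le> (dist (contract A \<theta> x) (contract A \<theta> y))\<^sup>2"
    by (simp add: dist_norm u_def)
  then show ?thesis by (rule power2_le_imp_le) simp
qed

text \<open>A slight contraction moves a point at distance exactly \<open>r\<close> from
  \<open>A\<close> into the open parallel set.\<close>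

lemma closure_parallel_set:
  assumes "0 < r" shows "closure (parallel_set A r) = {x. infdist x A \<le> r}"
proof
  have "closed {x. infdist x A \<le> r}" by (intro closed_Collect_le continuous_intros)
  then show "closure (parallel_set A r) \<subseteq> {x. infdist x A \<le> r}"
    by (rule closure_minimal[rotated]) (auto simp: parallel_set_def)
  show "{x. infdist x A \<le> r} \<subseteq> closure (parallel_set A r)"
  proof
    fix x assume "x \<in> {x. infdist x A \<le> r}"
    then have x: "infdist x A \<le> r" by simp
    show "x \<in> closure (parallel_set A r)"
      unfolding closure_approachable
    proof (intro allI impI)
      fix e :: real assume e: "0 < e"
      \<comment> \<open>The contraction then moves \<open>x\<close> by at most
        \<open>e / 2\<close>.\<close>
      define \<theta> where "\<theta> = 1 - min 1 (e / (2 * r))"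
      have \<theta>: "0 \<le> \<theta>" "\<theta> < 1" "1 - \<theta> \<le> e / (2 * r)"
        using e assms by (auto simp: \<theta>_def)
      have "\<theta> * infdist x A \<le> \<theta> * r" using x \<theta> by (intro mult_left_mono) auto
      also have "\<dots> < r" using \<theta> assms by simp
      finally have "contract A \<theta> x \<in> parallel_set A r"
        using infdist_contract(1)[of \<theta> x] \<theta> by (simp add: parallel_set_def)
      moreover have "(1 - \<theta>) * infdist x A \<le> e / (2 * r) * r"
        using x \<theta> assms e by (intro mult_mono) (auto simp: infdist_nonneg)
      then have "dist (contract A \<theta> x) x < e"
        using infdist_contract(2)[of \<theta> x] \<theta> e assms by (simp add: dist_commute)
      ultimately show "\<exists>y\<in>parallel_set A r. dist y x < e" by blast
    qed
  qed
qed

lemma frontier_parallel_set: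
  assumes "0 < r" shows "frontier (parallel_set A r) = {x. infdist x A = r}"
  unfolding frontier_def closure_parallel_set[OF assms] interior_open[OF open_parallel_set]
  by (auto simp: parallel_set_def)

section \<open>Volumes of parallel sets and shells\<close>

lemma parallel_set_finite: "emeasure lborel (parallel_set A r) < \<infinity>"
  by (rule emeasure_bounded_finite) (simp add: bounded_parallel_set compact_imp_bounded compact nonempty)

lemma parallel_set_fmeasurable: "parallel_set A r \<in> fmeasurable lborel"
  using parallel_set_finite by (intro fmeasurableI) (simp_all add: open_parallel_set)

lemma shell_fmeasurable: "shell A a b \<in> fmeasurable lborel"
  by (rule fmeasurableI2[OF parallel_set_fmeasurable[of b]])
    (auto simp: shell_subset_parallel_set shell_borel)

lemma volume_function_eq: "volume_function A r = measure lborel (parallel_set A r)"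
  unfolding volume_function_def by (simp add: open_parallel_set)

lemma volume_function_diff:
  assumes "a \<le> b"
  shows "volume_function A b - volume_function A a = measure lborel (shell A a b)"
proof -
  have "measure lborel (parallel_set A b - parallel_set A a)
      = measure lborel (parallel_set A b) - measure lborel (parallel_set A a)"
    using assms by (intro measurable_measure_Diff parallel_set_fmeasurable)
      (auto simp: parallel_set_def intro!: borel_open open_parallel_set[unfolded parallel_set_def])
  moreover have "parallel_set A b - parallel_set A a = shell A a b"
    using assms by (auto simp: parallel_set_def shell_def)
  ultimately show ?thesis by (simp add: volume_function_eq)
qed

lemma volume_function_mono: "a \<le> b \<Longrightarrow> volume_function A a \<le> volume_function A b"
  using volume_function_diff[of a b] measure_nonneg[of lborel "shell A a b"] by linarith

text \<open>For \<open>\<mu> \<ge> 1\<close>, the witness \<open>x\<close> lies on the prolongation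
  beyond \<open>y\<close> of a segment from a nearest point, and that point is still nearest to
  \<open>x\<close>. This describes the points reached by contraction with factor
  \<open>1 / \<mu>\<close>; an existential condition replaces the image of \<open>contract\<close>
  because it is closed, hence Borel.\<close>

definition extendable :: "real \<Rightarrow> real \<Rightarrow> real \<Rightarrow> 'a set" where
  "extendable \<mu> a b = {y \<in> shell A a b. \<exists>x. infdist x A = \<mu> * infdist y A \<and> dist x y = (\<mu> - 1) * infdist y A}"

text \<open>Witnesses for a convergent sequence stay bounded, and the limit of a subsequence of them
  is a witness for the limit point.\<close>

lemma extendable_borel: "extendable \<mu> a b \<in> sets borel"
proof -
  define F where "F = {y. \<exists>x. infdist x A = \<mu> * infdist y A \<and> dist x y = (\<mu> - 1) * infdist y A}"
  have "closed F"
    unfolding closed_sequential_limits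
  proof (intro allI impI)
    fix y l assume "(\<forall>n. y n \<in> F) \<and> y \<longlonglongrightarrow> l"
    then have yF: "\<And>n. y n \<in> F" and y: "y \<longlonglongrightarrow> l" by auto
    then obtain x where x: "\<And>n. infdist (x n) A = \<mu> * infdist (y n) A" "\<And>n. dist (x n) (y n) = (\<mu> - 1) * infdist (y n) A"
      unfolding F_def by (simp add: choice_iff) metis
    have "bounded (range y)" using y by (simp add: convergent_imp_bounded)
    then obtain B where B: "\<And>n. norm (y n) \<le> B" by (auto simp: bounded_iff)
    have "(\<lambda>n. (\<mu> - 1) * infdist (y n) A) \<longlonglongrightarrow> (\<mu> - 1) * infdist l A"
      using y by (intro tendsto_intros)
    then have "bounded (range (\<lambda>n. (\<mu> - 1) * infdist (y n) A))" by (rule convergent_imp_bounded)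
    then obtain B' where B': "\<And>n. \<bar>(\<mu> - 1) * infdist (y n) A\<bar> \<le> B'" by (auto simp: bounded_iff)
    have "norm (x n) \<le> B + B'" for n
      using B[of n] B'[of n] x(2)[of n] norm_triangle_sub[of "x n" "y n"] by (simp add: dist_norm)
    then have "bounded (range x)" by (auto simp: bounded_iff)
    then obtain m s where s: "strict_mono s" "(x \<circ> s) \<longlonglongrightarrow> m"
      using bounded_imp_convergent_subsequence by metis
    have ys: "(y \<circ> s) \<longlonglongrightarrow> l" using y s(1) by (rule LIMSEQ_subseq_LIMSEQ)
    have "(\<lambda>n. infdist ((x \<circ> s) n) A) \<longlonglongrightarrow> infdist m A"
      by (intro tendsto_intros s)
    moreover have "(\<lambda>n. \<mu> * infdist ((y \<circ> s) n) A) \<longlonglongrightarrow> \<mu> * infdist l A"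
      by (intro tendsto_intros ys)
    moreover have "(\<lambda>n. dist ((x \<circ> s) n) ((y \<circ> s) n)) \<longlonglongrightarrow> dist m l"
      by (intro tendsto_intros s ys)
    moreover have "(\<lambda>n. (\<mu> - 1) * infdist ((y \<circ> s) n) A) \<longlonglongrightarrow> (\<mu> - 1) * infdist l A"
      by (intro tendsto_intros ys)
    ultimately have "infdist m A = \<mu> * infdist l A" "dist m l = (\<mu> - 1) * infdist l A"
      using x by (auto intro: LIMSEQ_unique)
    then show "l \<in> F" by (auto simp: F_def)
  qed
  moreover have "extendable \<mu> a b = shell A a b \<inter> F" by (auto simp: extendable_def F_def)
  ultimately show ?thesis by (simp add: borel_closed)
qed

lemma extendable_fmeasurable: "extendable \<mu> a b \<in> fmeasurable lborel"
  by (rule fmeasurableI2[OF shell_fmeasurable[of a b]]) (auto simp: extendable_def extendable_borel[unfolded extendable_def])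

text \<open>Contraction by \<open>1 / \<mu>\<close> maps the larger shell into the extendable part
  of the smaller one, the original point serving as the witness, and its inverse is
  \<open>\<mu>\<close>-Lipschitz.\<close>

lemma shell_le_extendable:
  assumes \<mu>: "1 \<le> \<mu>"
  shows "measure lborel (shell A (\<mu> * a) (\<mu> * b)) \<le> \<mu> ^ DIM('a) * measure lborel (extendable \<mu> a b)"
proof -
  define f where "f = contract A (1 / \<mu>)"
  have f: "infdist (f x) A = infdist x A / \<mu>" "dist x (f x) = (1 - 1 / \<mu>) * infdist x A"
     "dist x y \<le> \<mu> * dist (f x) (f y)" for x y
    using \<mu> infdist_contract[of "1/\<mu>" x] dist_contract_ge[of "1/\<mu>" x y]
    by (auto simp: f_def field_simps)
  have "emeasure lborel (shell A (\<mu> * a) (\<mu> * b)) \<le> ennreal (\<mu> ^ DIM('a)) * emeasure lborel (extendable \<mu> a b)"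
  proof (rule emeasure_le_expanding[where f = f])
    show "f ` shell A (\<mu> * a) (\<mu> * b) \<subseteq> extendable \<mu> a b"
    proof
      fix y assume "y \<in> f ` shell A (\<mu> * a) (\<mu> * b)"
      then obtain x where x: "y = f x" "\<mu> * a \<le> infdist x A" "infdist x A < \<mu> * b"
        by (auto simp: shell_def)
      have e: "infdist x A = \<mu> * infdist y A"
        using \<mu> f(1)[of x] by (simp add: x(1) field_simps)
      moreover have "dist x y = (\<mu> - 1) * infdist y A"
      proof -
        have "dist x y = (1 - 1 / \<mu>) * (\<mu> * infdist y A)"
          using f(2)[of x] unfolding x(1)[symmetric] e .
        also have "\<dots> = (\<mu> - 1) * infdist y A"
          using \<mu> by (simp add: left_diff_distrib)
        finally show ?thesis .
      qed
      moreover have "y \<in> shell A a b"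
        using x(2,3) \<mu> unfolding e by (simp add: shell_def)
      ultimately show "y \<in> extendable \<mu> a b" by (auto simp: extendable_def)
    qed
  qed (use \<mu> f in \<open>auto simp: extendable_borel shell_borel\<close>)
  also have "\<dots> = ennreal (\<mu> ^ DIM('a) * measure lborel (extendable \<mu> a b))"
    using \<mu> extendable_fmeasurable by (simp add: emeasure_eq_measure2 ennreal_mult)
  finally show ?thesis
    using \<mu> shell_fmeasurable by (simp add: emeasure_eq_measure2)
qed

lemma shell_scale_le:
  assumes "1 \<le> \<mu>"
  shows "measure lborel (shell A (\<mu> * a) (\<mu> * b)) \<le> \<mu> ^ DIM('a) * measure lborel (shell A a b)"
proof -
  have "measure lborel (extendable \<mu> a b) \<le> measure lborel (shell A a b)"
    by (rule measure_mono_fmeasurable[OF _ fmeasurableD[OF extendable_fmeasurable] shell_fmeasurable])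
      (auto simp: extendable_def)
  then show ?thesis using shell_le_extendable[OF assms, of a b] assms
    by (meson mult_left_mono order_trans zero_le_power zero_le_one)
qed

text \<open>Contracting a piece of the shell by the factors \<open>\<theta>^k\<close> gives about \<open>\<rho>/h\<close> disjoint sets of
  comparable measure.\<close>

lemma shell_piece_le:
  assumes h: "0 < h" "h \<le> \<rho>" "\<rho> \<le> r / 2"
    and S: "S \<in> sets borel" "S \<subseteq> shell A (r - h) r"
    and B: "B \<in> fmeasurable lborel" "\<And>y. y \<in> S \<Longrightarrow> cball y \<rho> \<subseteq> B"
  shows "measure lborel S \<le> 2 ^ (DIM('a) + 1) * h / \<rho> * measure lborel B"
proof -
  \<comment> \<open>\<open>\<theta>\<close> carries level \<open>r\<close> to level
    \<open>r - h\<close>, so the powers of \<open>\<theta>\<close> produce consecutive shells. Up to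
    \<open>n\<close> of them can be used before the displacement exceeds \<open>\<rho>\<close>;
    since \<open>h \<le> \<rho>\<close>, rounding down loses at most a factor 2.\<close>
  define \<theta> where "\<theta> = 1 - h / r"
  define n where "n = nat \<lfloor>\<rho> / h\<rfloor>"
  have r: "r > 0" using h by linarith
  have \<theta>: "0 < \<theta>" "\<theta> < 1" using h r by (auto simp: \<theta>_def field_simps)
  have n: "real n \<le> \<rho> / h" "\<rho> / (2 * h) \<le> real n"
  proof -
    have fl: "1 \<le> \<lfloor>\<rho> / h\<rfloor>" using h by (simp add: le_floor_iff)
    then have "real n = of_int \<lfloor>\<rho> / h\<rfloor>" by (simp add: n_def)
    then show "real n \<le> \<rho> / h" "\<rho> / (2 * h) \<le> real n"
      using fl by (auto, linarith+)
  qed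
  \<comment> \<open>The first bound limits the displacement to \<open>\<rho>\<close>. The second
    makes the inverse of each contraction 2-Lipschitz, and this is where
    \<open>\<rho> \<le> r / 2\<close> enters.\<close>
  have \<theta>k: "1 - \<rho> / r \<le> \<theta> ^ k" "1 / 2 \<le> \<theta> ^ k" if "k < n" for k
  proof -
    have "1 + real k * (- (h / r)) \<le> (1 + - (h / r)) ^ k"
      using h r by (intro Bernoulli_inequality) (auto simp: field_simps)
    moreover have "real k * h \<le> \<rho>"
    proof -
      have "real k * h \<le> real n * h" using that h by (intro mult_right_mono) auto
      also have "\<dots> \<le> \<rho>" using n(1) h by (simp add: field_simps)
      finally show ?thesis .
    qed
    then have "real k * (h / r) \<le> \<rho> / r" using r by (simp add: divide_right_mono)
    ultimately show 1: "1 - \<rho> / r \<le> \<theta> ^ k" by (simp add: \<theta>_def)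
    have "\<rho> / r \<le> 1 / 2" using h r by (simp add: field_simps)
    then show "1 / 2 \<le> \<theta> ^ k" using 1 by linarith
  qed
  define T where "T k = B \<inter> shell A (r * \<theta> ^ Suc k) (r * \<theta> ^ k)" for k
  have Tf: "T k \<in> fmeasurable lborel" for k
    unfolding T_def using B shell_fmeasurable by (intro fmeasurable.Int) auto
  have Sf: "S \<in> fmeasurable lborel"
    using S by (intro fmeasurableI2[OF shell_fmeasurable]) auto
  have ST: "measure lborel S \<le> 2 ^ DIM('a) * measure lborel (T k)" if k: "k < n" for k
  proof -
    have "\<theta> ^ k \<le> 1" "0 < \<theta> ^ k" using \<theta> by (auto simp: power_le_one)
    note p = this
    have "emeasure lborel S \<le> ennreal (2 ^ DIM('a)) * emeasure lborel (T k)"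
    proof (rule emeasure_le_expanding[where f = "contract A (\<theta> ^ k)"])
      show "contract A (\<theta> ^ k) ` S \<subseteq> T k"
      proof
        fix y assume "y \<in> contract A (\<theta> ^ k) ` S"
        then obtain x where x: "x \<in> S" "y = contract A (\<theta> ^ k) x" by auto
        then have ix: "r - h \<le> infdist x A" "infdist x A < r" using S by (auto simp: shell_def)
        have y: "infdist y A = \<theta> ^ k * infdist x A" "dist x y = (1 - \<theta> ^ k) * infdist x A"
          using infdist_contract[of "\<theta> ^ k" x] p x by auto
        have "(1 - \<theta> ^ k) * infdist x A \<le> \<rho> / r * r"
          using \<theta>k(1)[OF k] ix p h r by (intro mult_mono) (auto simp: infdist_nonneg)
        then have "y \<in> B" using B(2)[OF x(1)] y r by auto
        moreover have "r * \<theta> = r - h" using r by (simp add: \<theta>_def field_simps)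
        then have "\<theta> ^ k * (r * \<theta>) \<le> \<theta> ^ k * infdist x A"
          using ix p by (intro mult_left_mono) auto
        moreover have "\<theta> ^ k * infdist x A < \<theta> ^ k * r"
          using ix p by (intro mult_strict_left_mono) auto
        ultimately show "y \<in> T k" by (simp add: T_def shell_def y mult_ac)
      qed
      fix x y :: 'a
      have "1 / 2 * dist x y \<le> \<theta> ^ k * dist x y" using \<theta>k(2)[OF k] by (intro mult_right_mono) auto
      also have "\<dots> \<le> dist (contract A (\<theta> ^ k) x) (contract A (\<theta> ^ k) y)"
        using p by (intro dist_contract_ge) auto
      finally show "dist x y \<le> 2 * dist (contract A (\<theta> ^ k) x) (contract A (\<theta> ^ k) y)" by simp
    qed (use S fmeasurableD[OF Tf] in auto)
    also have "\<dots> = ennreal (2 ^ DIM('a) * measure lborel (T k))"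
      using Tf by (simp add: emeasure_eq_measure2 ennreal_mult)
    finally show ?thesis using Sf by (simp add: emeasure_eq_measure2)
  qed
  have disj: "T j \<inter> T k = {}" if "j < k" for j k
  proof -
    have "\<theta> ^ k \<le> \<theta> ^ Suc j" using that \<theta> by (intro power_decreasing) auto
    then have "r * \<theta> ^ k \<le> r * \<theta> ^ Suc j" using r by simp
    then show ?thesis by (auto simp: T_def shell_def simp del: power_Suc)
  qed
  have disjf: "disjoint_family_on T {..<n}"
    unfolding disjoint_family_on_def
  proof (intro ballI impI)
    fix j k :: nat assume "j \<noteq> k"
    then show "T j \<inter> T k = {}" using disj[of j k] disj[of k j] by (metis Int_commute nat_neq_iff)
  qed
  have "\<rho> / (2 * h) * measure lborel S \<le> real n * measure lborel S"
    using n by (intro mult_right_mono) auto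
  also have "\<dots> = (\<Sum>k<n. measure lborel S)" by simp
  also have "\<dots> \<le> (\<Sum>k<n. 2 ^ DIM('a) * measure lborel (T k))"
    by (intro sum_mono ST) auto
  also have "\<dots> = 2 ^ DIM('a) * measure lborel (\<Union>k<n. T k)"
    using disjf fmeasurableD[OF Tf] fmeasurableD2[OF Tf]
    by (subst measure_finite_Union) (auto simp: sum_distrib_left)
  also have "\<dots> \<le> 2 ^ DIM('a) * measure lborel B"
    using Tf B by (intro mult_left_mono measure_mono_fmeasurable) (auto simp: T_def)
  finally show ?thesis using h by (simp add: field_simps)
qed

end

section \<open>From differentiability to the positive boundary\<close>

text \<open>A crude linear bound that turns the scaling factor \<open>\<mu> ^ DIM('a)\<close> into
  \<open>1 + O(h)\<close>.\<close>

lemma one_plus_power_le: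
  fixes u :: real
  assumes "0 \<le> u" "u \<le> 1"
  shows "(1 + u) ^ n \<le> 1 + 4 ^ n * u"
proof (induction n)
  case (Suc n)
  have "(1 + u) ^ Suc n \<le> (1 + u) * (1 + 4 ^ n * u)"
    using Suc assms by (simp add: mult_left_mono)
  also have "\<dots> = 1 + u + 4 ^ n * u + 4 ^ n * u * u" by (simp add: algebra_simps)
  also have "\<dots> \<le> 1 + 4 ^ Suc n * u"
  proof -
    have "1 * u \<le> 4 ^ n * u" using assms by (intro mult_right_mono) auto
    moreover have "4 ^ n * u * u \<le> 4 ^ n * u * 1" using assms by (intro mult_left_mono) auto
    moreover have "(4::real) ^ Suc n * u = 4 * (4 ^ n * u)" by simp
    ultimately show ?thesis using assms by linarith
  qed
  finally show ?case .
qed (use assms in simp)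

section \<open>Volume increments near the radius \<open>r\<close>\<close>

context
  fixes A :: "'a::euclidean_space set" and r :: real
  assumes compact: "compact A" and nonempty: "A \<noteq> {}" and r: "0 < r"
begin

text \<open>The shell estimate \<open>shell_piece_le\<close> is applied to a whole shell with
  \<open>\<rho> = r / 8\<close>.\<close>

lemma volume_function_locally_Lipschitz:
  obtains C where "0 < C" "\<And>t h. r / 2 \<le> t \<Longrightarrow> t \<le> 2 * r \<Longrightarrow> 0 < h \<Longrightarrow> h \<le> r / 8 \<Longrightarrow>
    volume_function A t - volume_function A (t - h) \<le> C * h"
proof
  \<comment> \<open>Radius \<open>3 * r\<close> leaves room for the
    \<open>r / 8\<close>-neighbourhood of any shell below \<open>2 * r\<close>. The constant
    \<open>C + 1\<close> below is positive without a lower bound on \<open>M\<close>.\<close>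
  define M where "M = measure lborel (parallel_set A (3 * r))"
  define C where "C = 2 ^ (DIM('a) + 1) * M / (r / 8)"
  have M: "0 \<le> M" by (simp add: M_def)
  then show "0 < C + 1" using r by (simp add: C_def add_nonneg_pos)
  fix t h :: real
  assume t: "r / 2 \<le> t" "t \<le> 2 * r" and h: "0 < h" "h \<le> r / 8"
  have "measure lborel (shell A (t - h) t) \<le> 2 ^ (DIM('a) + 1) * h / (r / 8) * measure lborel (parallel_set A (3 * r))"
  proof (rule shell_piece_le[OF compact nonempty h(1,2), of t])
    fix y assume "y \<in> shell A (t - h) t"
    show "cball y (r / 8) \<subseteq> parallel_set A (3 * r)"
    proof (intro subsetI)
      fix w assume "w \<in> cball y (r / 8)"
      then show "w \<in> parallel_set A (3 * r)"
        using \<open>y \<in> shell A (t - h) t\<close> t r infdist_triangle[of w A y]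
        by (simp add: shell_def parallel_set_def dist_commute)
    qed
  qed (use t r parallel_set_fmeasurable[OF compact nonempty] in \<open>auto simp: shell_borel\<close>)
  also have "\<dots> = C * h" by (simp add: C_def M_def)
  also have "\<dots> \<le> (C + 1) * h" using h by simp
  finally show "volume_function A t - volume_function A (t - h) \<le> (C + 1) * h"
    using h volume_function_diff[OF compact nonempty, of "t - h" t] by simp
qed

text \<open>Scaling by \<open>\<mu> = t / (t - h)\<close> sends the shell from \<open>t - h\<close>
  to \<open>t\<close> to one that starts at \<open>t\<close> and reaches at least
  \<open>t + h\<close>. So the outer increment exceeds the inner one by at most the factor
  \<open>\<mu> ^ DIM('a) = 1 + O(h)\<close>, while the inner increment is itself
  \<open>O(h)\<close>.\<close>

lemma volume_function_semiconcave:
  obtains C where "\<And>t h. 0 < h \<Longrightarrow> r - r / 16 \<le> t - h \<Longrightarrow> t + h \<le> r + r / 16 \<Longrightarrow>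
    volume_function A (t + h) + volume_function A (t - h) - 2 * volume_function A t \<le> C * h\<^sup>2"
proof -
  obtain C where C: "0 < C" "\<And>t h. r / 2 \<le> t \<Longrightarrow> t \<le> 2 * r \<Longrightarrow> 0 < h \<Longrightarrow> h \<le> r / 8 \<Longrightarrow>
    volume_function A t - volume_function A (t - h) \<le> C * h"
    by (rule volume_function_locally_Lipschitz) blast
  show thesis
  proof
    fix t h assume h: "0 < h" and th: "r - r / 16 \<le> t - h" "t + h \<le> r + r / 16"
    define \<mu> where "\<mu> = t / (t - h)"
    have th': "r / 2 \<le> t - h" "t \<le> 2 * r" "h \<le> r / 8" using th h r by auto
    have \<mu>: "1 \<le> \<mu>" "\<mu> * (t - h) = t" using th' h r by (auto simp: \<mu>_def field_simps)
    have "t + h \<le> \<mu> * t"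
    proof -
      have "(t + h) * (t - h) \<le> t * t" by (simp add: algebra_simps)
      then show ?thesis using th' r by (simp add: \<mu>_def field_simps)
    qed
    then have "volume_function A (t + h) - volume_function A t \<le> volume_function A (\<mu> * t) - volume_function A t"
      using volume_function_mono[OF compact nonempty] by simp
    also have "\<dots> = measure lborel (shell A (\<mu> * (t - h)) (\<mu> * t))"
      using \<mu> \<open>t + h \<le> \<mu> * t\<close> h by (subst volume_function_diff[OF compact nonempty]) auto
    also have "\<dots> \<le> \<mu> ^ DIM('a) * measure lborel (shell A (t - h) t)"
      by (rule shell_scale_le[OF compact nonempty \<mu>(1)])
    also have "measure lborel (shell A (t - h) t) = volume_function A t - volume_function A (t - h)"
      using h by (subst volume_function_diff[OF compact nonempty]) auto
    finally have 1: "volume_function A (t + h) - volume_function A t \<le> \<mu> ^ DIM('a) * (volume_function A t - volume_function A (t - h))" .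
    \<comment> \<open>An upper bound for \<open>\<mu> - 1 = h / (t - h)\<close>, because
      \<open>t - h \<ge> r / 2\<close>.\<close>
    define u where "u = 2 * h / r"
    have u: "0 \<le> u" "u \<le> 1" using h th' r by (auto simp: u_def)
    have "\<mu> = 1 + h / (t - h)" using th' r by (auto simp: \<mu>_def field_simps)
    also have "h / (t - h) \<le> h / (r / 2)" using h th' r by (intro divide_left_mono) auto
    finally have "\<mu> \<le> 1 + u" by (simp add: u_def mult.commute)
    then have "\<mu> ^ DIM('a) \<le> (1 + u) ^ DIM('a)" using \<mu> by (intro power_mono) auto
    also have "\<dots> \<le> 1 + 4 ^ DIM('a) * u" using u by (rule one_plus_power_le)
    finally have 2: "\<mu> ^ DIM('a) - 1 \<le> 4 ^ DIM('a) * u" by simp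
    have "volume_function A (t + h) + volume_function A (t - h) - 2 * volume_function A t
      \<le> (\<mu> ^ DIM('a) - 1) * (volume_function A t - volume_function A (t - h))"
      using 1 by (simp add: algebra_simps)
    also have "\<dots> \<le> 4 ^ DIM('a) * u * (C * h)"
      using 2 C(2)[of t h] u th' h r volume_function_mono[OF compact nonempty, of "t - h" t]
      by (intro mult_mono) auto
    also have "\<dots> = (4 ^ DIM('a) * 2 / r * C) * h\<^sup>2" by (simp add: u_def power2_eq_square)
    finally show "volume_function A (t + h) + volume_function A (t - h) - 2 * volume_function A t
      \<le> (4 ^ DIM('a) * 2 / r * C) * h\<^sup>2" .
  qed
qed

text \<open>Semiconcavity bounds the second difference from above by \<open>C * h\<^sup>2\<close>,
  so only the lower bound has to be assumed.\<close>

lemma volume_function_differentiable_if: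
  assumes le: "\<And>e. 0 < e \<Longrightarrow> eventually (\<lambda>h. volume_function A r - volume_function A (r - h)
      \<le> volume_function A (r + h) - volume_function A r + e * h) (at_right 0)"
  shows "volume_function A differentiable (at r)"
proof -
  define V where "V = volume_function A"
  obtain C where C: "\<And>t h. 0 < h \<Longrightarrow> r - r / 16 \<le> t - h \<Longrightarrow> t + h \<le> r + r / 16 \<Longrightarrow>
    V (t + h) + V (t - h) - 2 * V t \<le> C * h\<^sup>2"
    unfolding V_def by (rule volume_function_semiconcave) blast
  obtain L where L: "0 < L" "\<And>t h. r / 2 \<le> t \<Longrightarrow> t \<le> 2 * r \<Longrightarrow> 0 < h \<Longrightarrow> h \<le> r / 8 \<Longrightarrow>
    V t - V (t - h) \<le> L * h"
    unfolding V_def by (rule volume_function_locally_Lipschitz) blast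
  have mono: "V s \<le> V t" if "s \<le> t" for s t
    unfolding V_def using volume_function_mono[OF compact nonempty that] .
  have Lip: "\<bar>V s - V t\<bar> \<le> L * \<bar>s - t\<bar>"
    if "s \<le> t" "s \<in> {r - r / 16..r + r / 16}" "t \<in> {r - r / 16..r + r / 16}" for s t
    using that L(2)[of t "t - s"] mono[of s t] r by (cases "s = t") auto
  have cont: "continuous_on {r - r / 16..r + r / 16} V"
  proof (rule lipschitz_on_continuous_on[of L], rule lipschitz_onI)
    fix s t assume "s \<in> {r - r / 16..r + r / 16}" "t \<in> {r - r / 16..r + r / 16}"
    then show "dist (V s) (V t) \<le> L * dist s t"
      using Lip[of s t] Lip[of t s] by (cases "s \<le> t") (auto simp: dist_real_def abs_minus_commute)
  qed (use L in simp)
  have "((\<lambda>h. (V (r + h) + V (r - h) - 2 * V r) / h) \<longlongrightarrow> 0) (at_right 0)"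
  proof (rule tendstoI)
    fix e :: real assume e: "0 < e"
    \<comment> \<open>Below \<open>k\<close> the interval stays in the range of semiconcavity, and
      \<open>C * h\<^sup>2 < e * h\<close>.\<close>
    define k where "k = min (r / 16) (e / (\<bar>C\<bar> + 1))"
    have k: "0 < k" using e r by (simp add: k_def add_nonneg_pos)
    have ev: "eventually (\<lambda>h. 0 < h \<and> h < k) (at_right (0::real))"
      using eventually_at_right_real[OF k] by eventually_elim auto
    have "eventually (\<lambda>h. V r - V (r - h) \<le> V (r + h) - V r + e / 2 * h) (at_right 0)"
      using le[of "e / 2"] e by (simp add: V_def)
    with ev show "eventually (\<lambda>h. dist ((V (r + h) + V (r - h) - 2 * V r) / h) 0 < e) (at_right 0)"
    proof eventually_elim
      case (elim h)
      then have h: "0 < h" "h < r / 16" "h < e / (\<bar>C\<bar> + 1)" by (auto simp: k_def)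
      have "h * (\<bar>C\<bar> + 1) < e" using h(3) by (simp add: field_simps add_nonneg_pos)
      moreover have "h * C \<le> h * (\<bar>C\<bar> + 1)" using h(1) by (intro mult_left_mono) auto
      ultimately have "C * h < e" by (simp add: mult.commute)
      then have "C * h\<^sup>2 < e * h" using h(1) by (simp add: power2_eq_square)
      then have "V (r + h) + V (r - h) - 2 * V r < e * h"
        using C[OF h(1), of r] h by auto
      moreover have "- (e * h) < V (r + h) + V (r - h) - 2 * V r"
        using elim(2) mult_pos_pos[OF e h(1)] by (simp add: field_simps)
      ultimately show ?case using h(1) by (simp add: abs_less_iff field_simps)
    qed
  qed
  then show ?thesis
    using differentiable_if_second_difference[of "r / 16" r V C] r cont C unfolding V_def by auto
qed

text \<open>The point \<open>x\<close> is the exterior witness: every \<open>w\<close> with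
  \<open>infdist w A < r\<close> is farther from it than \<open>infdist x A - r\<close>.\<close>

lemma positive_boundaryI:
  assumes "infdist z A = r" "r < infdist x A" "dist x z = infdist x A - r"
  shows "z \<in> positive_boundary (parallel_set A r)"
proof -
  have zf: "z \<in> frontier (parallel_set A r)"
    using assms frontier_parallel_set[OF compact nonempty r] by simp
  then have "closure (parallel_set A r) \<noteq> {}" "z \<in> closure (parallel_set A r)"
    by (auto simp: frontier_def)
  then have ne: "parallel_set A r \<noteq> {}" by auto
  have "infdist x (parallel_set A r) \<le> dist x z"
    using infdist_triangle[of x "parallel_set A r" z] \<open>z \<in> closure (parallel_set A r)\<close>
      in_closure_iff_infdist_zero[OF ne, of z] by simp
  moreover have "dist x z \<le> infdist x (parallel_set A r)"
    unfolding infdist_notempty[OF ne]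
  proof (rule cINF_greatest[OF ne])
    fix w assume "w \<in> parallel_set A r"
    then show "dist x z \<le> dist x w"
      using assms infdist_triangle[of x A w] by (simp add: parallel_set_def)
  qed
  moreover have "x \<notin> closure (parallel_set A r)"
    using assms closure_parallel_set[OF compact nonempty r] by simp
  ultimately show ?thesis using zf by (auto simp: positive_boundary_def)
qed

text \<open>A witness of extendability would lie on the ray from the nearest point of
  \<open>z\<close> through \<open>z\<close>, strictly beyond \<open>z\<close>, and would put
  \<open>z\<close> into the positive boundary.\<close>

lemma contract_not_extendable:
  assumes z: "infdist z A = r" "z \<notin> positive_boundary (parallel_set A r)"
    and t: "0 < t" "t < h" "h < r"
  shows "contract A (1 - t / r) z \<in> shell A (r - h) r - extendable A (r / (r - h)) (r - h) r"
proof
  define y where "y = contract A (1 - t / r) z"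
  have tr: "0 < 1 - t / r" "1 - t / r < 1" using t by (auto simp: field_simps)
  have iy: "infdist y A = r - t"
    using infdist_contract(1)[OF compact nonempty, of "1 - t / r" z] tr z r
    by (simp add: y_def left_diff_distrib)
  then show "y \<in> shell A (r - h) r" using t by (simp add: shell_def)
  define \<mu> where "\<mu> = r / (r - h)"
  show "y \<notin> extendable A \<mu> (r - h) r"
  proof
    assume "y \<in> extendable A \<mu> (r - h) r"
    then obtain x where x: "infdist x A = \<mu> * (r - t)" "dist x y = (\<mu> - 1) * (r - t)"
      by (auto simp: extendable_def[OF compact nonempty] iy)
    define a where "a = proj A z"
    have aA: "a \<in> A" and za: "norm (z - a) = r"
      using proj_in[OF compact nonempty, of z] dist_proj[OF compact nonempty, of z] z by (auto simp: a_def dist_norm)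
    have ya: "y - a = (1 - t / r) *\<^sub>R (z - a)" by (simp add: y_def a_def contract_def)
    then have nya: "norm (y - a) = r - t" using tr za r by (simp add: left_diff_distrib)
    \<comment> \<open>Equality in the triangle inequality places \<open>x\<close> on the ray from
      \<open>a\<close> through \<open>y\<close>, which also contains \<open>z\<close>.\<close>
    have "dist x a = dist x y + dist y a"
      using infdist_le[OF aA, of x] dist_triangle[of x a y] x nya by (simp add: dist_norm algebra_simps)
    then have "norm (x - y) *\<^sub>R (y - a) = norm (y - a) *\<^sub>R (x - y)"
      by (simp add: dist_triangle_eq)
    then have "(r - t) *\<^sub>R ((\<mu> - 1) *\<^sub>R (y - a)) = (r - t) *\<^sub>R (x - y)"
      using x(2) nya by (simp add: dist_norm mult.commute)
    then have xy: "x - y = (\<mu> - 1) *\<^sub>R (y - a)"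
      unfolding scaleR_cancel_left using t by auto
    have "x - z = (x - y) + (y - a) - (z - a)" by simp
    also have "\<dots> = \<mu> *\<^sub>R (y - a) - (z - a)" unfolding xy by (simp add: scaleR_left_diff_distrib)
    also have "\<dots> = (\<mu> * (1 - t / r) - 1) *\<^sub>R (z - a)" unfolding ya by (metis scaleR_scaleR scaleR_left_diff_distrib scaleR_one)
    finally have "x - z = (\<mu> * (1 - t / r) - 1) *\<^sub>R (z - a)" .
    \<comment> \<open>By \<open>t < h\<close>, prolonging from level \<open>r - t\<close> by the
      factor \<open>r / (r - h)\<close> overshoots the level \<open>r\<close>.\<close>
    moreover have "r < \<mu> * (r - t)"
      using t r by (simp add: \<mu>_def field_simps)
    moreover have "(\<mu> * (1 - t / r) - 1) * r = \<mu> * (r - t) - r" using r by (simp add: field_simps)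
    moreover from this \<open>r < \<mu> * (r - t)\<close> have "0 < \<mu> * (1 - t / r) - 1"
      using r by (metis diff_gt_0_iff_gt zero_less_mult_pos2)
    ultimately have "dist x z = infdist x A - r" "r < infdist x A"
      using za x r by (auto simp: dist_norm)
    then show False using positive_boundaryI z by blast
  qed
qed

text \<open>The extendable part has measure at least \<open>(1 / \<mu>) ^ d\<close> times the outer
  increment, hence the outer increment up to \<open>O(h\<^sup>2)\<close>. Differentiability makes
  the two increments agree up to \<open>o(h)\<close>, so little of the inner shell remains.\<close>

lemma not_extendable_measure:
  assumes "volume_function A differentiable (at r)" "0 < e"
  shows "eventually (\<lambda>h. measure lborel (shell A (r - h) r - extendable A (r / (r - h)) (r - h) r) \<le> e * h) (at_right 0)"
proof -
  define V where "V = volume_function A"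
  obtain L where L: "0 < L" "\<And>t h. r / 2 \<le> t \<Longrightarrow> t \<le> 2 * r \<Longrightarrow> 0 < h \<Longrightarrow> h \<le> r / 8 \<Longrightarrow>
    V t - V (t - h) \<le> L * h"
    unfolding V_def by (rule volume_function_locally_Lipschitz) blast
  define d :: nat where "d = DIM('a)"
  have d: "0 < d" by (simp add: d_def)
  \<comment> \<open>The second bound keeps the quadratic error \<open>d * (h / r) * (L * h)\<close>
    below \<open>e / 2 * h\<close>.\<close>
  define k where "k = min (r / 8) (e / 2 / (d / r * L))"
  have k: "0 < k" using assms(2) r L d by (simp add: k_def)
  have ev: "eventually (\<lambda>h. 0 < h \<and> h < k) (at_right (0::real))"
    using eventually_at_right_real[OF k] by eventually_elim auto
  have "eventually (\<lambda>h. dist ((V (r + h) + V (r - h) - 2 * V r) / h) 0 < e / 2) (at_right 0)"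
    using second_difference_tendsto_0[OF assms(1)] assms(2) unfolding V_def by (intro tendstoD) auto
  with ev show ?thesis
  proof eventually_elim
    case (elim h)
    then have h: "0 < h" "h < r / 8" "h < e / 2 / (d / r * L)" by (auto simp: k_def)
    define \<mu> where "\<mu> = r / (r - h)"
    have \<mu>: "1 \<le> \<mu>" "\<mu> * (r - h) = r" using h r by (auto simp: \<mu>_def)
    have m: "r + h \<le> \<mu> * r"
    proof -
      have "(r + h) * (r - h) \<le> r * r" by (simp add: algebra_simps)
      then show ?thesis using h r by (simp add: \<mu>_def field_simps)
    qed
    have "V (r + h) - V r \<le> V (\<mu> * r) - V r"
      using volume_function_mono[OF compact nonempty m] by (simp add: V_def)
    also have "\<dots> = measure lborel (shell A (\<mu> * (r - h)) (\<mu> * r))"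
      using \<mu> m h unfolding V_def by (subst volume_function_diff[OF compact nonempty]) auto
    also have "\<dots> \<le> \<mu> ^ d * measure lborel (extendable A \<mu> (r - h) r)"
      unfolding d_def by (rule shell_le_extendable[OF compact nonempty \<mu>(1)])
    finally have "(1 / \<mu>) ^ d * (V (r + h) - V r) \<le> measure lborel (extendable A \<mu> (r - h) r)"
      using \<mu> by (simp add: field_simps power_divide)
    moreover have "1 - d * (h / r) \<le> (1 / \<mu>) ^ d"
      using Bernoulli_inequality[of "- (h / r)" d] h r by (simp add: \<mu>_def field_simps)
    then have "(1 - d * (h / r)) * (V (r + h) - V r) \<le> (1 / \<mu>) ^ d * (V (r + h) - V r)"
      using volume_function_mono[OF compact nonempty, of r "r + h"] h by (intro mult_right_mono) (auto simp: V_def)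
    moreover have "d * (h / r) * (V (r + h) - V r) \<le> d * (h / r) * (L * h)"
      using L(2)[of "r + h" h] h r by (intro mult_left_mono) auto
    moreover have "d * (h / r) * (L * h) \<le> e / 2 * h"
    proof -
      have "h * (d / r * L) < e / 2" using h(3) d r L by (simp add: field_simps)
      then have "h * (d / r * L) * h \<le> e / 2 * h" using h by (intro mult_right_mono) auto
      then show ?thesis by (simp add: mult_ac)
    qed
    moreover have "\<bar>V (r + h) + V (r - h) - 2 * V r\<bar> < e / 2 * h"
      using elim(2) h(1) by (simp add: field_simps)
    moreover have "measure lborel (shell A (r - h) r - extendable A \<mu> (r - h) r)
      = V r - V (r - h) - measure lborel (extendable A \<mu> (r - h) r)"
    proof -
      have "measure lborel (shell A (r - h) r - extendable A \<mu> (r - h) r)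
        = measure lborel (shell A (r - h) r) - measure lborel (extendable A \<mu> (r - h) r)"
        by (rule measurable_measure_Diff[OF shell_fmeasurable[OF compact nonempty]
              fmeasurableD[OF extendable_fmeasurable[OF compact nonempty]]])
          (auto simp: extendable_def[OF compact nonempty])
      then show ?thesis using h volume_function_diff[OF compact nonempty, of "r - h" r] by (simp add: V_def)
    qed
    moreover have "(1 - d * (h / r)) * (V (r + h) - V r) = V (r + h) - V r - d * (h / r) * (V (r + h) - V r)"
      by (simp add: left_diff_distrib)
    ultimately show ?case unfolding \<mu>_def[symmetric] by linarith
  qed
qed

text \<open>Contraction sweeps the exceptional set through the non-extendable part \<open>N\<close>
  for all \<open>0 < t < h\<close>. Since \<open>N\<close> has measure at most \<open>e * h\<close>,
  the sweep inequality divided by \<open>h\<close> bounds the premeasure by a multiple of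
  \<open>e\<close>.\<close>

lemma differentiable_imp_positive_boundary_full:
  assumes diff: "volume_function A differentiable (at r)"
  shows "hausdorff_measure (DIM('a) - 1) (frontier (parallel_set A r) - positive_boundary (parallel_set A r)) = 0"
proof -
  define E where "E = frontier (parallel_set A r) - positive_boundary (parallel_set A r)"
  have E: "infdist z A = r" "z \<notin> positive_boundary (parallel_set A r)" if "z \<in> E" for z
    using that frontier_parallel_set[OF compact nonempty r] by (auto simp: E_def)
  define C where "C = unit_ball_vol (real (DIM('a) - 1)) * 10 ^ DIM('a) / unit_ball_vol (real DIM('a))"
  have C: "0 < C" by (simp add: C_def)
  have "hausdorff_premeasure (DIM('a) - 1) \<delta> E \<le> 0" if \<delta>: "0 < \<delta>" for \<delta>
  proof (rule ennreal_le_epsilon)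
    fix e0 :: real assume e0: "0 < e0"
    \<comment> \<open>Chosen so that \<open>C * (2 * e) = e0\<close>; the 2 pays for enlarging
      \<open>N\<close> to an open set, as the sweep inequality requires.\<close>
    define e where "e = e0 / (2 * C)"
    have e: "0 < e" using e0 C by (simp add: e_def)
    have "eventually (\<lambda>h. 0 < h \<and> h < r / 2) (at_right (0::real))"
      using eventually_at_right_real[of 0 "r / 2"] r by (auto elim: eventually_mono)
    with not_extendable_measure[OF diff e]
    have "eventually (\<lambda>h. measure lborel (shell A (r - h) r - extendable A (r / (r - h)) (r - h) r) \<le> e * h \<and> 0 < h \<and> h < r / 2) (at_right 0)"
      by eventually_elim auto
    then obtain h where hm: "measure lborel (shell A (r - h) r - extendable A (r / (r - h)) (r - h) r) \<le> e * h"
      and h: "0 < h" "h < r / 2"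
      using eventually_happens'[of "at_right (0::real)"] by (auto simp: trivial_limit_at_right_real)
    define N where "N = shell A (r - h) r - extendable A (r / (r - h)) (r - h) r"
    have Nf: "N \<in> fmeasurable lborel"
      unfolding N_def using shell_fmeasurable[OF compact nonempty] extendable_fmeasurable[OF compact nonempty] by (intro fmeasurable.Diff)
    have eh: "0 < e * h" using e h by simp
    obtain U where U: "open U" "N \<subseteq> U" "emeasure lborel (U - N) < e * h"
      using outer_regular_lborel[OF _ eh, of N] fmeasurableD[OF Nf] by auto
    have "emeasure lborel U = emeasure lborel N + emeasure lborel (U - N)"
      using U fmeasurableD[OF Nf] by (subst plus_emeasure) (auto simp: Un_absorb1)
    also have "\<dots> \<le> ennreal (e * h) + ennreal (e * h)"
      using hm U(3) Nf by (intro add_mono) (auto simp: emeasure_eq_measure2 N_def ennreal_leI)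
    also have "\<dots> = ennreal (2 * e * h)" using eh by (simp flip: ennreal_plus)
    finally have mU: "emeasure lborel U \<le> ennreal (2 * e * h)" .
    have "ennreal h * hausdorff_premeasure (DIM('a) - 1) \<delta> E \<le> ennreal C * emeasure lborel U"
      unfolding C_def
    proof (rule hausdorff_premeasure_le_sweep[where e = "\<lambda>t. contract A (1 - t / r)" and D = "\<lambda>x. infdist x A" and c = r,
          OF U(1) h(1) \<delta>])
      fix t z assume t: "0 < t" "t < h" and z: "z \<in> E"
      show "contract A (1 - t / r) z \<in> U"
        using contract_not_extendable[of z t h] E[OF z] t h U(2) by (auto simp: N_def)
      show "infdist (contract A (1 - t / r) z) A = r - t"
        using infdist_contract(1)[OF compact nonempty, of "1 - t / r" z] E[OF z] t h r by (simp add: left_diff_distrib)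
      fix w assume "w \<in> E"
      have "1 / 2 * dist z w \<le> (1 - t / r) * dist z w"
        using t h r by (intro mult_right_mono) (auto simp: field_simps)
      also have "\<dots> \<le> dist (contract A (1 - t / r) z) (contract A (1 - t / r) w)"
        using t h r by (intro dist_contract_ge[OF compact nonempty]) (auto simp: field_simps)
      finally show "dist z w \<le> 2 * dist (contract A (1 - t / r) z) (contract A (1 - t / r) w)" by simp
    qed (rule infdist_triangle_abs)
    also have "\<dots> \<le> ennreal C * ennreal (2 * e * h)" using mU by (intro mult_left_mono) auto
    also have "\<dots> = ennreal h * ennreal e0"
      using C e h e0 by (simp add: e_def ennreal_mult[symmetric] mult_ac)
    finally show "hausdorff_premeasure (DIM('a) - 1) \<delta> E \<le> 0 + ennreal e0"
      using h by (subst (asm) ennreal_mult_le_mult_iff) auto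
  qed
  then have "hausdorff_measure (DIM('a) - 1) E \<le> 0"
    unfolding hausdorff_measure_def by (intro SUP_least) auto
  then show ?thesis by (simp add: E_def)
qed

end

section \<open>Critical and regular boundary points\<close>

text \<open>Take a countable cover of small total weight and enclose each nonempty set in an open
  ball around one of its points, with radius slightly above the diameter. Compactness leaves
  finitely many balls.\<close>

lemma hausdorff_null_compact_cover:
  fixes K :: "'a::metric_space set"
  assumes K: "compact K" "hausdorff_measure m K = 0" and \<epsilon>: "0 < \<epsilon>" and \<eta>: "0 < \<eta>"
  obtains J :: "nat set" and x \<rho> where "finite J" "K \<subseteq> (\<Union>i\<in>J. ball (x i) (\<rho> i))"
    "\<And>i. i \<in> J \<Longrightarrow> 0 < \<rho> i \<and> \<rho> i < \<eta>" "(\<Sum>i\<in>J. \<rho> i ^ m) < \<epsilon>"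
proof -
  define w where "w = unit_ball_vol (real m) / 2 ^ m"
  have w: "0 < w" by (simp add: w_def)
  have "hausdorff_premeasure m (\<eta> / 2) K \<le> hausdorff_measure m K"
    unfolding hausdorff_measure_def using \<eta> by (intro SUP_upper) auto
  also have "\<dots> < ennreal (w * (\<epsilon> / 2))" using K w \<epsilon> by (simp add: ennreal_zero_less_mult_iff)
  finally obtain U :: "nat \<Rightarrow> 'a set" where U: "K \<subseteq> (\<Union>i. U i)" "\<And>i. bounded (U i)" "\<And>i. diameter (U i) \<le> \<eta> / 2"
    and sumU: "(\<Sum>i. hausdorff_weight m (U i)) < ennreal (w * (\<epsilon> / 2))"
    unfolding hausdorff_premeasure_def INF_less_iff by auto
  \<comment> \<open>The radius has to exceed the diameter for the ball to be open; the excess is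
    paid for by a geometric series of sum \<open>\<epsilon> / 2\<close>.\<close>
  have "\<exists>\<rho>. diameter (U i) < \<rho> \<and> \<rho> < \<eta> \<and> \<rho> ^ m < diameter (U i) ^ m + \<epsilon> / 2 * (1 / 2) ^ Suc i" for i
  proof -
    have "((\<lambda>\<rho>. \<rho> ^ m) \<longlongrightarrow> diameter (U i) ^ m) (at_right (diameter (U i)))"
      by (intro tendsto_intros)
    then have "eventually (\<lambda>\<rho>. \<rho> ^ m < diameter (U i) ^ m + \<epsilon> / 2 * (1 / 2) ^ Suc i) (at_right (diameter (U i)))"
      by (rule order_tendstoD) (use \<epsilon> in simp)
    moreover have "eventually (\<lambda>\<rho>. \<rho> \<in> {diameter (U i)<..<\<eta>}) (at_right (diameter (U i)))"
      using U(3)[of i] \<eta> by (intro eventually_at_right_real) auto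
    ultimately have "eventually (\<lambda>\<rho>. diameter (U i) < \<rho> \<and> \<rho> < \<eta> \<and> \<rho> ^ m < diameter (U i) ^ m + \<epsilon> / 2 * (1 / 2) ^ Suc i) (at_right (diameter (U i)))"
      by eventually_elim auto
    then show ?thesis using eventually_happens'[OF trivial_limit_at_right_real] by blast
  qed
  then obtain \<rho> where \<rho>: "\<And>i. diameter (U i) < \<rho> i" "\<And>i. \<rho> i < \<eta>"
    "\<And>i. \<rho> i ^ m < diameter (U i) ^ m + \<epsilon> / 2 * (1 / 2) ^ Suc i" by metis
  define x where "x i = (SOME x. x \<in> U i)" for i
  \<comment> \<open>Empty sets are discarded: they have no centre, and their weight is 0 even when
    \<open>m = 0\<close>.\<close>
  define I where "I = {i. U i \<noteq> {}}"
  have x: "x i \<in> U i" if "i \<in> I" for i using that unfolding I_def x_def by (auto intro: someI_ex)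
  have "K \<subseteq> (\<Union>i\<in>I. ball (x i) (\<rho> i))"
  proof
    fix y assume "y \<in> K"
    then obtain i where i: "y \<in> U i" using U(1) by auto
    then have "i \<in> I" by (auto simp: I_def)
    moreover have "dist (x i) y < \<rho> i"
      using diameter_bounded_bound[OF U(2)[of i] x[OF \<open>i \<in> I\<close>] i] \<rho>(1)[of i] by simp
    ultimately show "y \<in> (\<Union>i\<in>I. ball (x i) (\<rho> i))" by auto
  qed
  then obtain J where J: "J \<subseteq> I" "finite J" "K \<subseteq> (\<Union>i\<in>J. ball (x i) (\<rho> i))"
    by (rule compactE_image[OF K(1), rotated]) auto
  have "(\<Sum>i\<in>J. ennreal (w * diameter (U i) ^ m)) = (\<Sum>i\<in>J. hausdorff_weight m (U i))"
    using J(1) by (intro sum.cong) (auto simp: hausdorff_weight_def I_def w_def power_divide)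
  also have "\<dots> \<le> (\<Sum>i. hausdorff_weight m (U i))"
    using J(2) by (intro sum_le_suminf summableI) auto
  finally have "(\<Sum>i\<in>J. ennreal (w * diameter (U i) ^ m)) < ennreal (w * (\<epsilon> / 2))"
    using sumU by simp
  then have "ennreal (\<Sum>i\<in>J. w * diameter (U i) ^ m) < ennreal (w * (\<epsilon> / 2))"
    using w U(2) by (subst (asm) sum_ennreal) (auto simp: diameter_ge_0)
  then have "w * (\<Sum>i\<in>J. diameter (U i) ^ m) < w * (\<epsilon> / 2)"
    using w \<epsilon> by (simp add: ennreal_less_iff sum_nonneg sum_distrib_left diameter_ge_0 U(2))
  then have d: "(\<Sum>i\<in>J. diameter (U i) ^ m) < \<epsilon> / 2" using w by simp
  have "(\<Sum>i\<in>J. (1 / 2) ^ Suc i) \<le> (\<Sum>i. (1 / 2 :: real) ^ Suc i)"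
    using J(2) by (intro sum_le_suminf) (use power_half_series in \<open>auto simp: sums_iff\<close>)
  also have "\<dots> = 1" using power_half_series by (simp add: sums_iff)
  finally have "\<epsilon> / 2 * (\<Sum>i\<in>J. (1 / 2) ^ Suc i) \<le> \<epsilon> / 2 * 1"
    using \<epsilon> by (intro mult_left_mono) auto
  moreover have "(\<Sum>i\<in>J. \<rho> i ^ m) \<le> (\<Sum>i\<in>J. diameter (U i) ^ m + \<epsilon> / 2 * (1 / 2) ^ Suc i)"
    using \<rho>(3) by (intro sum_mono less_imp_le)
  ultimately have "(\<Sum>i\<in>J. \<rho> i ^ m) < \<epsilon>"
    using d by (simp only: sum.distrib sum_distrib_left[symmetric])
  moreover have "0 < \<rho> i" for i
    using \<rho>(1)[of i] diameter_ge_0[OF U(2)[of i]] by simp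
  ultimately show thesis using that J \<rho>(2) by blast
qed

text \<open>Fubini and translation invariance. Estimates on lines of direction \<open>v\<close> can
  thus be integrated over all base points \<open>y\<close> without rotating coordinates; the weight
  \<open>\<kappa>\<close> keeps the redundant integration finite.\<close>

lemma nn_integral_lines:
  fixes F :: "'a::euclidean_space \<Rightarrow> ennreal" and \<kappa> :: "real \<Rightarrow> ennreal"
  assumes [measurable]: "F \<in> borel_measurable borel" "\<kappa> \<in> borel_measurable borel"
  shows "(\<integral>\<^sup>+y. (\<integral>\<^sup>+\<tau>. \<kappa> \<tau> * F (y + \<tau> *\<^sub>R v) \<partial>lborel) \<partial>lborel)
    = (\<integral>\<^sup>+\<tau>. \<kappa> \<tau> \<partial>lborel) * (\<integral>\<^sup>+x. F x \<partial>lborel)"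
proof -
  have trans: "(\<integral>\<^sup>+y. F (y + u) \<partial>lborel) = (\<integral>\<^sup>+x. F x \<partial>lborel)" for u
  proof -
    have "(\<integral>\<^sup>+x. F x \<partial>lborel) = (\<integral>\<^sup>+x. F x \<partial>(distr lborel borel ((+) u)))"
      by (simp only: lborel_distr_plus)
    also have "\<dots> = (\<integral>\<^sup>+y. F (u + y) \<partial>lborel)" by (subst nn_integral_distr) auto
    finally show ?thesis by (simp add: add.commute)
  qed
  have "(\<integral>\<^sup>+y. (\<integral>\<^sup>+\<tau>. \<kappa> \<tau> * F (y + \<tau> *\<^sub>R v) \<partial>lborel) \<partial>lborel)
    = (\<integral>\<^sup>+\<tau>. (\<integral>\<^sup>+y. \<kappa> \<tau> * F (y + \<tau> *\<^sub>R v) \<partial>lborel) \<partial>lborel)"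
    by (rule lborel_pair.Fubini') measurable
  also have "\<dots> = (\<integral>\<^sup>+\<tau>. \<kappa> \<tau> * (\<integral>\<^sup>+x. F x \<partial>lborel) \<partial>lborel)"
    by (subst nn_integral_cmult) (auto simp: trans)
  also have "\<dots> = (\<integral>\<^sup>+\<tau>. \<kappa> \<tau> \<partial>lborel) * (\<integral>\<^sup>+x. F x \<partial>lborel)"
    by (rule nn_integral_multc) measurable
  finally show ?thesis .
qed

text \<open>Substitute \<open>c - s\<close> on the left and \<open>c + s\<close> on the right, so
  that the values compared are those at mirror points.\<close>

lemma nn_integral_reflect_le:
  fixes F G :: "real \<Rightarrow> ennreal"
  assumes [measurable]: "F \<in> borel_measurable borel" "G \<in> borel_measurable borel"
    and le: "\<And>s. F (c - s) \<le> G (c + s) + ennreal \<omega> * indicator {0..l} s" and l: "0 \<le> l"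
  shows "(\<integral>\<^sup>+\<tau>. F \<tau> \<partial>lborel) \<le> (\<integral>\<^sup>+\<tau>. G \<tau> \<partial>lborel) + ennreal \<omega> * ennreal l"
proof -
  have "(\<integral>\<^sup>+\<tau>. F \<tau> \<partial>lborel) = (\<integral>\<^sup>+s. F (c - s) \<partial>lborel)"
    using nn_integral_real_affine[of F "-1" c] by simp
  also have "\<dots> \<le> (\<integral>\<^sup>+s. G (c + s) + ennreal \<omega> * indicator {0..l} s \<partial>lborel)"
    using le by (intro nn_integral_mono)
  also have "\<dots> = (\<integral>\<^sup>+s. G (c + s) \<partial>lborel) + (\<integral>\<^sup>+s. ennreal \<omega> * indicator {0..l} s \<partial>lborel)"
    by (rule nn_integral_add) measurable
  also have "(\<integral>\<^sup>+s. G (c + s) \<partial>lborel) = (\<integral>\<^sup>+\<tau>. G \<tau> \<partial>lborel)"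
    using nn_integral_real_affine[of G 1 c] by simp
  also have "(\<integral>\<^sup>+s. ennreal \<omega> * indicator {0..l} s \<partial>lborel) = ennreal \<omega> * ennreal l"
    using l by (subst nn_integral_cmult_indicator) auto
  finally show ?thesis .
qed

text \<open>Moving along \<open>v\<close> increases the distance at a definite rate. Separate points
  \<open>x\<close> and \<open>y\<close> allow a nearest point of one point of a line to be tested
  against another point. The radius \<open>4 * \<rho>\<close> accommodates base points within
  \<open>2 * \<rho>\<close> of \<open>z\<close> and line parameters up to
  \<open>2 * \<rho>\<close>.\<close>

definition regular_direction :: "'a::euclidean_space set \<Rightarrow> 'a \<Rightarrow> real \<Rightarrow> 'a \<Rightarrow> real \<Rightarrow> bool" where
  "regular_direction A z \<rho> v c \<longleftrightarrow> norm v = 1 \<and> 0 < c \<and> 0 < \<rho> \<and>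
    (\<forall>x\<in>ball z (4 * \<rho>). \<forall>y\<in>ball z (4 * \<rho>). \<forall>a\<in>nearest_points A y. c \<le> (x - a) \<bullet> v)"

section \<open>Regular points and closedness of the critical set\<close>

context
  fixes A :: "'a::euclidean_space set"
  assumes compact: "compact A" and nonempty: "A \<noteq> {}"
begin

lemma nearest_points_compact: "compact (nearest_points A x)"
proof -
  have "nearest_points A x = A \<inter> {a. dist a x = infdist x A}" by (auto simp: nearest_points_def)
  moreover have "closed {a. dist a x = infdist x A}" by (intro closed_Collect_eq continuous_intros)
  ultimately show ?thesis using compact by (simp add: compact_Int_closed)
qed

text \<open>At a regular point the nearest points lie strictly on one side of a hyperplane, and by upper
  semicontinuity of the metric projection this persists in a neighbourhood.\<close>

lemma not_crit_direction:
  assumes "z \<notin> crit A"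
  shows "\<exists>v c \<rho>. regular_direction A z \<rho> v c"
proof -
  have "compact (convex hull (nearest_points A z))"
    by (intro compact_convex_hull nearest_points_compact)
  then have "closed (convex hull (nearest_points A z))" by (rule compact_imp_closed)
  then obtain u b where u: "u \<bullet> z < b" "\<And>x. x \<in> convex hull (nearest_points A z) \<Longrightarrow> b < u \<bullet> x"
    using separating_hyperplane_closed_point[of "convex hull (nearest_points A z)" z] assms
    by (auto simp: crit_def)
  have "b < u \<bullet> proj A z"
    using proj_nearest[OF compact nonempty, of z] by (intro u(2) hull_inc)
  then have u0: "u \<noteq> 0" using u(1) by auto
  define v where "v = - u /\<^sub>R norm u"
  define c where "c = (b - u \<bullet> z) / norm u"
  have v: "norm v = 1" using u0 by (simp add: v_def)
  have c: "0 < c" using u(1) u0 by (simp add: c_def)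
  have zc: "c \<le> (z - a) \<bullet> v" if "a \<in> nearest_points A z" for a
  proof -
    have "b < u \<bullet> a" using that by (intro u(2) hull_inc)
    moreover have "(z - a) \<bullet> v = (u \<bullet> a - u \<bullet> z) / norm u"
      using u0 by (simp add: v_def inner_diff_left inner_commute divide_inverse algebra_simps)
    ultimately show ?thesis using u0 by (simp add: c_def divide_right_mono)
  qed
  \<comment> \<open>Otherwise nearest points of a sequence tending to \<open>z\<close> would
    accumulate, by compactness of \<open>A\<close>, at a nearest point of \<open>z\<close> violating
    \<open>zc\<close>.\<close>
  have "\<exists>\<delta>>0. \<forall>y a. dist z y < \<delta> \<longrightarrow> a \<in> nearest_points A y \<longrightarrow> c / 2 \<le> (z - a) \<bullet> v"
  proof (rule ccontr)
    assume "\<not> ?thesis"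
    then have "\<forall>n::nat. \<exists>y a. dist z y < 1 / Suc n \<and> a \<in> nearest_points A y \<and> (z - a) \<bullet> v < c / 2"
      by (metis not_le zero_less_divide_1_iff of_nat_0_less_iff zero_less_Suc)
    then obtain y a where ya: "\<And>n. dist z (y n) < 1 / Suc n" "\<And>n. a n \<in> nearest_points A (y n)"
      "\<And>n::nat. (z - a n) \<bullet> v < c / 2" by metis
    have "(\<lambda>n. dist (y n) z) \<longlonglongrightarrow> 0"
      by (rule tendsto_sandwich[OF _ _ tendsto_const LIMSEQ_inverse_real_of_nat])
        (use ya(1) in \<open>auto simp: dist_commute inverse_eq_divide intro!: always_eventually less_imp_le\<close>)
    then have y: "y \<longlonglongrightarrow> z" by (subst tendsto_dist_iff)
    have "\<forall>n. a n \<in> A" using ya(2) nearest_pointsD(1) by blast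
    then obtain l s where l: "l \<in> A" "strict_mono s" "(a \<circ> s) \<longlonglongrightarrow> l"
      using compact unfolding compact_def by blast
    have ys: "(y \<circ> s) \<longlonglongrightarrow> z" using y l(2) by (rule LIMSEQ_subseq_LIMSEQ)
    have "(\<lambda>n. dist ((y \<circ> s) n) ((a \<circ> s) n)) \<longlonglongrightarrow> dist z l" by (intro tendsto_intros ys l)
    moreover have "(\<lambda>n. dist ((y \<circ> s) n) ((a \<circ> s) n)) \<longlonglongrightarrow> infdist z A"
      using tendsto_infdist[OF ys, of A] nearest_pointsD(2)[OF ya(2)] by (simp add: o_def)
    ultimately have "dist z l = infdist z A" by (rule LIMSEQ_unique)
    then have "c \<le> (z - l) \<bullet> v" using l(1) by (intro zc) (auto simp: nearest_points_def dist_commute)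
    moreover have "(\<lambda>n. (z - (a \<circ> s) n) \<bullet> v) \<longlonglongrightarrow> (z - l) \<bullet> v" by (intro tendsto_intros l)
    then have "(z - l) \<bullet> v \<le> c / 2"
      by (rule LIMSEQ_le_const2) (use ya(3) in \<open>auto intro: less_imp_le\<close>)
    ultimately show False using c by simp
  qed
  then obtain \<delta> where \<delta>: "0 < \<delta>" "\<And>y a. dist z y < \<delta> \<Longrightarrow> a \<in> nearest_points A y \<Longrightarrow> c / 2 \<le> (z - a) \<bullet> v"
    by blast
  \<comment> \<open>Within \<open>4 * \<rho>\<close> the bound \<open>c / 2\<close> for nearest
    points holds, and replacing \<open>z\<close> by \<open>x\<close> costs less than
    \<open>c / 4\<close>.\<close>
  define \<rho> where "\<rho> = min \<delta> (c / 4) / 4"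
  have "regular_direction A z \<rho> v (c / 4)"
    unfolding regular_direction_def
  proof (intro conjI ballI)
    show "norm v = 1" by fact
    show "0 < c / 4" "0 < \<rho>" using c \<delta> by (auto simp: \<rho>_def)
    fix x y a assume x: "x \<in> ball z (4 * \<rho>)" and y: "y \<in> ball z (4 * \<rho>)" and a: "a \<in> nearest_points A y"
    have "c / 2 \<le> (z - a) \<bullet> v" using y a by (intro \<delta>(2)) (auto simp: \<rho>_def)
    moreover have "\<bar>(x - z) \<bullet> v\<bar> \<le> norm (x - z) * norm v" by (rule Cauchy_Schwarz_ineq2)
    moreover have "norm (x - z) < c / 4" using x by (auto simp: \<rho>_def dist_norm norm_minus_commute)
    ultimately show "c / 4 \<le> (x - a) \<bullet> v"
      using v by (simp add: inner_diff_left abs_le_iff)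
  qed
  then show ?thesis by blast
qed

text \<open>The complement of \<open>crit A\<close> is open: throughout a regular ball the nearest
  points of \<open>y\<close> lie in a half-space excluding \<open>y\<close>, and so does their
  convex hull.\<close>

lemma compact_frontier_crit: "compact ({x. infdist x A = r} \<inter> crit A)"
  unfolding compact_eq_bounded_closed
proof
  have "{x. infdist x A = r} \<subseteq> parallel_set A (r + 1)" by (auto simp: parallel_set_def)
  then show "bounded ({x. infdist x A = r} \<inter> crit A)"
    using bounded_parallel_set[OF compact_imp_bounded[OF compact] nonempty] bounded_subset by blast
  have "open (- crit A)"
    unfolding open_contains_ball
  proof
    fix z assume "z \<in> - crit A"
    then obtain v c \<rho> where v: "regular_direction A z \<rho> v c"
      using not_crit_direction by blast
    have "y \<notin> crit A" if y: "y \<in> ball z (4 * \<rho>)" for y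
    proof
      assume "y \<in> crit A"
      moreover have "convex hull (nearest_points A y) \<subseteq> {a. v \<bullet> a \<le> v \<bullet> y - c}"
      proof (rule hull_minimal)
        show "nearest_points A y \<subseteq> {a. v \<bullet> a \<le> v \<bullet> y - c}"
        proof
          fix a assume "a \<in> nearest_points A y"
          then have "c \<le> (y - a) \<bullet> v" using v y by (auto simp: regular_direction_def)
          then show "a \<in> {a. v \<bullet> a \<le> v \<bullet> y - c}" by (simp add: inner_diff_left inner_commute[of v])
        qed
      qed (rule convex_halfspace_le)
      ultimately show False using v by (auto simp: crit_def regular_direction_def)
    qed
    then show "\<exists>e>0. ball z e \<subseteq> - crit A" using v by (intro exI[of _ "4 * \<rho>"]) (auto simp: regular_direction_def)
  qed
  then have "closed (crit A)" by (simp add: closed_def)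
  moreover have "closed {x. infdist x A = r}" by (intro closed_Collect_eq continuous_intros)
  ultimately show "closed ({x. infdist x A = r} \<inter> crit A)" by (rule closed_Int[rotated])
qed

end

section \<open>The inner shell near a null set\<close>

context
  fixes A :: "'a::euclidean_space set" and r :: real
  assumes compact: "compact A" and nonempty: "A \<noteq> {}" and r: "0 < r"
begin

text \<open>In a ball of radius \<open>\<rho>\<close> the inner shell has measure at most
  \<open>C * h * \<rho> ^ (d - 1)\<close>, by \<open>shell_piece_le\<close>. Summing over a finite
  cover with small total \<open>(d - 1)\<close>-weight gives \<open>e * h\<close>.\<close>

lemma shell_near_null:
  assumes K: "compact K" "hausdorff_measure (DIM('a) - 1) K = 0" and e: "0 < e"
  shows "\<exists>U. open U \<and> K \<subseteq> U \<and>
    eventually (\<lambda>h. measure lborel (shell A (r - h) r \<inter> U) \<le> e * h) (at_right 0)"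
proof -
  define d :: nat where "d = DIM('a)"
  have d: "0 < d" by (simp add: d_def)
  define C where "C = 2 ^ (d + 1) * unit_ball_vol (real d) * 2 ^ d"
  have C: "0 < C" by (simp add: C_def)
  have eC: "0 < e / C" and r2: "0 < r / 2" using e C r by auto
  obtain J :: "nat set" and x \<rho> where J: "finite J" "K \<subseteq> (\<Union>i\<in>J. ball (x i) (\<rho> i))"
    "\<And>i. i \<in> J \<Longrightarrow> 0 < \<rho> i \<and> \<rho> i < r / 2" "(\<Sum>i\<in>J. \<rho> i ^ (d - 1)) < e / C"
    using hausdorff_null_compact_cover[OF K eC r2] unfolding d_def by blast
  define U where "U = (\<Union>i\<in>J. ball (x i) (\<rho> i))"
  have ball: "measure lborel (shell A (r - h) r \<inter> ball (x i) (\<rho> i)) \<le> C * h * \<rho> i ^ (d - 1)"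
    if i: "i \<in> J" and h: "0 < h" "h < \<rho> i" for i h
  proof -
    have \<rho>: "0 < \<rho> i" "\<rho> i \<le> r / 2" using J(3)[OF i] by auto
    have "measure lborel (shell A (r - h) r \<inter> ball (x i) (\<rho> i))
      \<le> 2 ^ (d + 1) * h / \<rho> i * measure lborel (cball (x i) (2 * \<rho> i))"
      unfolding d_def
    proof (rule shell_piece_le[OF compact nonempty h(1) less_imp_le[OF h(2)] \<rho>(2)])
      fix y assume y: "y \<in> shell A (r - h) r \<inter> ball (x i) (\<rho> i)"
      show "cball y (\<rho> i) \<subseteq> cball (x i) (2 * \<rho> i)"
      proof
        fix u assume "u \<in> cball y (\<rho> i)"
        then show "u \<in> cball (x i) (2 * \<rho> i)"
          using y dist_triangle[of "x i" u y] by simp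
      qed
    qed (auto simp: shell_borel intro: fmeasurable_compact)
    also have "measure lborel (cball (x i) (2 * \<rho> i)) = unit_ball_vol (real d) * (2 * \<rho> i) ^ d"
      using \<rho> by (simp add: content_cball d_def)
    also have "\<rho> i ^ d = \<rho> i * \<rho> i ^ (d - 1)" using d by (cases d) auto
    then have "2 ^ (d + 1) * h / \<rho> i * (unit_ball_vol (real d) * (2 * \<rho> i) ^ d) = C * h * \<rho> i ^ (d - 1)"
      using \<rho> by (simp add: C_def power_mult_distrib)
    finally show ?thesis .
  qed
  have "eventually (\<lambda>h. \<forall>i\<in>J. h < \<rho> i) (at_right (0::real))"
    using J by (intro eventually_ball_finite ballI eventually_at_rightI[of 0 "\<rho> _"]) auto
  moreover have "eventually (\<lambda>h. 0 < h) (at_right (0::real))"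
    by (rule eventually_at_right_less)
  ultimately have "eventually (\<lambda>h. measure lborel (shell A (r - h) r \<inter> U) \<le> e * h) (at_right 0)"
  proof eventually_elim
    case (elim h)
    have "measure lborel (shell A (r - h) r \<inter> U) = measure lborel (\<Union>i\<in>J. shell A (r - h) r \<inter> ball (x i) (\<rho> i))"
      by (auto simp: U_def intro!: arg_cong[where f = "measure lborel"])
    also have "\<dots> \<le> (\<Sum>i\<in>J. measure lborel (shell A (r - h) r \<inter> ball (x i) (\<rho> i)))"
      using J(1) shell_fmeasurable[OF compact nonempty]
      by (intro measure_UNION_le) (auto simp: shell_borel)
    also have "\<dots> \<le> (\<Sum>i\<in>J. C * h * \<rho> i ^ (d - 1))"
      using elim by (intro sum_mono ball) auto
    also have "\<dots> = C * h * (\<Sum>i\<in>J. \<rho> i ^ (d - 1))" by (simp add: sum_distrib_left)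
    also have "\<dots> \<le> C * h * (e / C)"
      using J(4) C elim by (intro mult_left_mono) auto
    finally show ?case using C by (simp add: mult.commute)
  qed
  then show ?thesis using J(2) by (intro exI[of _ U]) (auto simp: U_def)
qed

end

section \<open>Comparison of the inner and outer shells\<close>

lemma exists_pos_lower_bound_compact:
  fixes f :: "'b::topological_space \<Rightarrow> real"
  assumes "compact S" "continuous_on S f" "\<And>x. x \<in> S \<Longrightarrow> 0 < f x"
  shows "\<exists>m>0. \<forall>x\<in>S. m \<le> f x"
proof (cases "S = {}")
  case False
  then obtain x where "x \<in> S" "\<And>y. y \<in> S \<Longrightarrow> f x \<le> f y"
    using continuous_attains_inf[OF assms(1) _ assms(2)] by blast
  then show ?thesis using assms(3) by blast
qed (auto intro: exI[of _ 1])

context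
  fixes A :: "'a::euclidean_space set" and r :: real
  assumes compact: "compact A" and nonempty: "A \<noteq> {}" and r: "0 < r"
begin

text \<open>On a line in a direction that increases the distance, the squared distance \<open>f\<close> satisfies
  \<open>f (\<tau>0 + s) + f (\<tau>0 - s) \<le> 2 * f \<tau>0 + 2 * s\<^sup>2\<close>; so reflection at the crossing point \<open>\<tau>0\<close> of the
  level \<open>r\<close> maps the inner shell into a slightly enlarged outer shell.\<close>

lemma shell_line_reflection:
  assumes dir: "regular_direction A z \<rho> v c"
    and h: "0 < h" "h < r" "r * h / c < \<rho> / 2" "r / c\<^sup>2 * h \<le> e" and e: "0 < e"
    and y: "y \<in> ball z (2 * \<rho>)"
    and \<tau>1: "\<bar>\<tau>1\<bar> < \<rho>" "y + \<tau>1 *\<^sub>R v \<in> shell A (r - h) r"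
  obtains \<tau>0 where "\<bar>\<tau>0\<bar> < 2 * \<rho>"
    "\<And>\<tau>. \<bar>\<tau>\<bar> < \<rho> \<Longrightarrow> y + \<tau> *\<^sub>R v \<in> shell A (r - h) r \<Longrightarrow>
      0 \<le> \<tau>0 - \<tau> \<and> \<tau>0 - \<tau> \<le> r * h / c \<and> y + (\<tau>0 + (\<tau>0 - \<tau>)) *\<^sub>R v \<in> shell A r (r + (1 + e) * h)"
proof -
  have v: "norm v = 1" "0 < c" "0 < \<rho>"
    and reg: "\<And>x y a. x \<in> ball z (4 * \<rho>) \<Longrightarrow> y \<in> ball z (4 * \<rho>) \<Longrightarrow> a \<in> nearest_points A y \<Longrightarrow> c \<le> (x - a) \<bullet> v"
    using dir by (auto simp: regular_direction_def)
  define f where "f \<tau> = (infdist (y + \<tau> *\<^sub>R v) A)\<^sup>2" for \<tau>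
  \<comment> \<open>The width of the inner shell along the line: \<open>f\<close> grows at rate at
    least \<open>2 * c\<close>, and across the shell it changes by at most
    \<open>2 * r * h = 2 * c * l\<close>.\<close>
  define l where "l = r * h / c"
  have l: "0 < l" "l < \<rho> / 2" using r h v by (auto simp: l_def)
  have in_ball: "y + \<tau> *\<^sub>R v \<in> ball z (4 * \<rho>)" if "\<bar>\<tau>\<bar> < 2 * \<rho>" for \<tau>
    using y that v dist_triangle[of z "y + \<tau> *\<^sub>R v" y] by (simp add: dist_norm)
  \<comment> \<open>A nearest point of the upper end is a competitor for the lower end. The
    difference of the squared distances to it is governed by the midpoint \<open>m\<close>, where
    regularity applies.\<close>
  have f_mono: "2 * c * (\<tau>' - \<tau>) \<le> f \<tau>' - f \<tau>" if "\<bar>\<tau>\<bar> < 2 * \<rho>" "\<bar>\<tau>'\<bar> < 2 * \<rho>" "\<tau> \<le> \<tau>'" for \<tau> \<tau>'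
  proof -
    define x where "x = y + \<tau> *\<^sub>R v"
    define x' where "x' = y + \<tau>' *\<^sub>R v"
    define a where "a = proj A x'"
    define m where "m = y + ((\<tau> + \<tau>') / 2) *\<^sub>R v"
    have a: "a \<in> nearest_points A x'" unfolding a_def by (rule proj_nearest[OF compact nonempty])
    have "c \<le> (m - a) \<bullet> v"
      using a that in_ball[of \<tau>'] in_ball[of "(\<tau> + \<tau>') / 2"] by (intro reg[of m x']) (auto simp: m_def x'_def)
    have "f \<tau> \<le> (dist x a)\<^sup>2"
      unfolding f_def x_def[symmetric] using nearest_pointsD(1)[OF a] by (intro power_mono) (auto simp: infdist_le infdist_nonneg)
    moreover have "f \<tau>' = (dist x' a)\<^sup>2"
      unfolding f_def x'_def[symmetric] using nearest_pointsD(2)[OF a] by simp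
    moreover have "(dist x' a)\<^sup>2 - (dist x a)\<^sup>2 = 2 * (\<tau>' - \<tau>) * ((m - a) \<bullet> v)"
    proof -
      define \<delta> where "\<delta> = (\<tau>' - \<tau>) / 2"
      have "\<tau>' = (\<tau> + \<tau>') / 2 + \<delta>" "\<tau> = (\<tau> + \<tau>') / 2 - \<delta>" by (auto simp: \<delta>_def field_simps)
      then have "x' = m + \<delta> *\<^sub>R v" "x = m - \<delta> *\<^sub>R v"
        unfolding x_def x'_def m_def by (metis add.assoc scaleR_left_distrib, metis add_diff_eq scaleR_left_diff_distrib)
      then have eqs: "x' - a = (m - a) + \<delta> *\<^sub>R v" "x - a = (m - a) - \<delta> *\<^sub>R v" by auto
      have "(norm (p + \<delta> *\<^sub>R v))\<^sup>2 - (norm (p - \<delta> *\<^sub>R v))\<^sup>2 = 4 * \<delta> * (p \<bullet> v)" for p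
        unfolding power2_norm_eq_inner
        by (simp add: inner_add_left inner_add_right inner_diff_left inner_diff_right inner_commute)
      moreover have "2 * (\<tau>' - \<tau>) = 4 * \<delta>" by (simp add: \<delta>_def)
      ultimately show ?thesis unfolding dist_norm eqs by simp
    qed
    moreover have "2 * (\<tau>' - \<tau>) * c \<le> 2 * (\<tau>' - \<tau>) * ((m - a) \<bullet> v)"
      using \<open>c \<le> (m - a) \<bullet> v\<close> that by (intro mult_left_mono) auto
    ultimately show ?thesis by (simp add: algebra_simps)
  qed
  \<comment> \<open>A nearest point of the middle is a competitor at both ends; the parallelogram
    identity does the rest.\<close>
  have f_mid: "f (\<tau> + s) + f (\<tau> - s) \<le> 2 * f \<tau> + 2 * s\<^sup>2" for \<tau> s
  proof -
    define x where "x = y + \<tau> *\<^sub>R v"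
    define a where "a = proj A x"
    have a: "a \<in> A" "dist x a = infdist x A"
      using proj_in[OF compact nonempty] dist_proj[OF compact nonempty] by (auto simp: a_def)
    have "f (\<tau> + t) \<le> (dist (x + t *\<^sub>R v) a)\<^sup>2" for t
      unfolding f_def using a(1)
      by (intro power_mono) (auto simp: x_def algebra_simps infdist_nonneg intro!: infdist_le)
    note this[of s] this[of "- s"]
    moreover have "(dist (x + s *\<^sub>R v) a)\<^sup>2 + (dist (x + (- s) *\<^sub>R v) a)\<^sup>2 = 2 * (dist x a)\<^sup>2 + 2 * s\<^sup>2 * (norm v)\<^sup>2"
      unfolding dist_norm power2_norm_eq_inner
      by (simp add: inner_add_left inner_add_right inner_diff_left inner_diff_right inner_commute algebra_simps power2_eq_square)
    ultimately show ?thesis using v a(2) by (simp add: f_def x_def)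
  qed
  have shell_f: "y + \<tau> *\<^sub>R v \<in> shell A a b \<longleftrightarrow> a\<^sup>2 \<le> f \<tau> \<and> f \<tau> < b\<^sup>2" if "0 \<le> a" "0 \<le> b" for a b \<tau>
    using that infdist_nonneg[of "y + \<tau> *\<^sub>R v" A]
    by (auto simp: f_def shell_def abs_le_square_iff[symmetric] power2_less_imp_less intro!: power_strict_mono)
  have inner_gap: "r\<^sup>2 - (r - h)\<^sup>2 \<le> 2 * c * l"
    using v by (simp add: l_def power2_eq_square algebra_simps)
  have f1: "(r - h)\<^sup>2 \<le> f \<tau>1" "f \<tau>1 < r\<^sup>2" using \<tau>1(2) h by (auto simp: shell_f)
  have "\<bar>\<tau>1\<bar> < 2 * \<rho>" "\<bar>\<tau>1 + l\<bar> < 2 * \<rho>" using \<tau>1(1) l by auto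
  then have "r\<^sup>2 \<le> f (\<tau>1 + l)" using f_mono[of \<tau>1 "\<tau>1 + l"] l inner_gap f1 by auto
  moreover have "continuous_on {\<tau>1..\<tau>1 + l} f" unfolding f_def by (intro continuous_intros)
  \<comment> \<open>The crossing point comes from \<open>\<tau>1\<close> alone, but serves every
    \<open>\<tau>\<close> of the line in the inner shell.\<close>
  ultimately obtain \<tau>0 where \<tau>0: "\<tau>1 \<le> \<tau>0" "\<tau>0 \<le> \<tau>1 + l" "f \<tau>0 = r\<^sup>2"
    using IVT'[of f \<tau>1 "r\<^sup>2" "\<tau>1 + l"] f1 l by auto
  have \<tau>0b: "\<bar>\<tau>0\<bar> < 2 * \<rho>" using \<tau>0 \<tau>1(1) l by auto
  show thesis
  proof (rule that[OF \<tau>0b], intro conjI)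
    fix \<tau> assume \<tau>: "\<bar>\<tau>\<bar> < \<rho>" and "y + \<tau> *\<^sub>R v \<in> shell A (r - h) r"
    then have f\<tau>: "(r - h)\<^sup>2 \<le> f \<tau>" "f \<tau> < r\<^sup>2" using h by (auto simp: shell_f)
    have \<tau>b: "\<bar>\<tau>\<bar> < 2 * \<rho>" using \<tau> by auto
    show s0: "0 \<le> \<tau>0 - \<tau>"
    proof (rule ccontr)
      assume "\<not> 0 \<le> \<tau>0 - \<tau>"
      then have "0 \<le> 2 * c * (\<tau> - \<tau>0)" "\<tau>0 \<le> \<tau>" using v by auto
      then show False using f_mono[OF \<tau>0b \<tau>b] f\<tau> \<tau>0 by auto
    qed
    have "2 * c * (\<tau>0 - \<tau>) \<le> 2 * c * l"
      using f_mono[OF \<tau>b \<tau>0b] s0 f\<tau> \<tau>0 inner_gap by auto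
    then have sl: "\<tau>0 - \<tau> \<le> l" using v by simp
    then show "\<tau>0 - \<tau> \<le> r * h / c" by (simp add: l_def)
    define s where "s = \<tau>0 - \<tau>"
    have s: "0 \<le> s" "s \<le> l" using s0 sl by (auto simp: s_def)
    have sb: "\<bar>\<tau>0 + s\<bar> < 2 * \<rho>" using \<tau> s l unfolding s_def by auto
    have "0 \<le> 2 * c * s" using s v by simp
    then have lo: "r\<^sup>2 \<le> f (\<tau>0 + s)" using f_mono[OF \<tau>0b sb] s \<tau>0 by auto
    \<comment> \<open>By \<open>r / c\<^sup>2 * h \<le> e\<close>, the error
      \<open>2 * s\<^sup>2\<close> is at most \<open>2 * r * h * e\<close>. This is what the
      widening of the outer shell from \<open>h\<close> to \<open>(1 + e) * h\<close>
      absorbs.\<close>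
    have "f (\<tau>0 + s) \<le> 2 * r\<^sup>2 - (r - h)\<^sup>2 + 2 * s\<^sup>2"
      using f_mid[of \<tau>0 s] f\<tau> \<tau>0 by (simp add: s_def)
    also have "s\<^sup>2 \<le> l\<^sup>2" using s by (intro power_mono) auto
    also have "l\<^sup>2 = r * h * (r / c\<^sup>2 * h)" by (simp add: l_def power2_eq_square)
    also have "r * h * (r / c\<^sup>2 * h) \<le> r * h * e" using h r by (intro mult_left_mono) auto
    finally have "f (\<tau>0 + s) \<le> 2 * r\<^sup>2 - (r - h)\<^sup>2 + 2 * (r * h * e)" by simp
    also have "\<dots> < (r + (1 + e) * h)\<^sup>2"
    proof -
      have "0 < h\<^sup>2 + ((1 + e) * h)\<^sup>2" using h by (simp add: add_pos_nonneg)
      then show ?thesis by (simp add: power2_eq_square algebra_simps)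
    qed
    finally have "y + (\<tau>0 + s) *\<^sub>R v \<in> shell A r (r + (1 + e) * h)"
      using lo r h e by (subst shell_f) auto
    then show "y + (\<tau>0 + (\<tau>0 - \<tau>)) *\<^sub>R v \<in> shell A r (r + (1 + e) * h)" by (simp add: s_def)
  qed
qed

text \<open>Integrate along lines of direction \<open>v\<close> with a tent weight \<open>k\<close>.
  On each line the reflection moves points by \<open>O(h)\<close>, so \<open>k * \<psi>\<close>
  changes by at most \<open>\<omega>\<close>, over a parameter range of length at most
  \<open>l = O(h)\<close>. Integration over lines multiplies both sides by \<open>X\<close>, which
  is then cancelled.\<close>

lemma shell_weighted_regular:
  fixes \<psi> :: "'a \<Rightarrow> real"
  assumes dir: "regular_direction A z \<rho> v c"
    and \<psi>: "continuous_on UNIV \<psi>" "\<And>x. 0 \<le> \<psi> x" "\<And>x. x \<notin> ball z \<rho> \<Longrightarrow> \<psi> x = 0"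
    and e: "0 < e"
  shows "eventually (\<lambda>h. (\<integral>\<^sup>+x. ennreal (\<psi> x) * indicator (shell A (r - h) r) x \<partial>lborel)
    \<le> (\<integral>\<^sup>+x. ennreal (\<psi> x) * indicator (shell A r (r + (1 + e) * h)) x \<partial>lborel) + ennreal (e * h)) (at_right 0)"
proof -
  have v: "norm v = 1" "0 < c" "0 < \<rho>" using dir by (auto simp: regular_direction_def)
  define k where "k \<tau> = max 0 (\<rho> - \<bar>\<tau>\<bar>)" for \<tau> :: real
  have k0: "0 \<le> k \<tau>" for \<tau> by (simp add: k_def)
  have contk: "continuous_on S k" for S unfolding k_def by (intro continuous_intros)
  have [measurable]: "k \<in> borel_measurable borel" by (rule borel_measurable_continuous_onI[OF contk])
  have [measurable]: "\<psi> \<in> borel_measurable borel" by (rule borel_measurable_continuous_onI[OF \<psi>(1)])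
  note shell_borel [measurable]
  define X where "X = (\<integral>\<^sup>+\<tau>. ennreal (k \<tau>) \<partial>lborel)"
  have X_lower: "ennreal (\<rho> / 2 * \<rho>) \<le> X"
  proof -
    have "ennreal (\<rho> / 2 * \<rho>) = (\<integral>\<^sup>+\<tau>. ennreal (\<rho> / 2) * indicator {-\<rho>/2..\<rho>/2} \<tau> \<partial>lborel)"
      using v by (subst nn_integral_cmult_indicator) (auto simp flip: ennreal_mult)
    also have "\<dots> \<le> X" unfolding X_def
      by (intro nn_integral_mono) (auto simp: k_def indicator_def intro!: ennreal_leI)
    finally show ?thesis .
  qed
  have X_upper: "X \<le> ennreal (\<rho> * (2 * \<rho>))"
  proof -
    have "X \<le> (\<integral>\<^sup>+\<tau>. ennreal \<rho> * indicator {-\<rho>..\<rho>} \<tau> \<partial>lborel)"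
      unfolding X_def using v by (intro nn_integral_mono) (auto simp: k_def indicator_def max_def intro!: ennreal_leI)
    also have "\<dots> = ennreal (\<rho> * (2 * \<rho>))"
      using v by (subst nn_integral_cmult_indicator) (auto simp: ennreal_mult)
    finally show ?thesis .
  qed
  define B where "B = measure lborel (ball z (2 * \<rho>)) + 1"
  have B: "0 < B" "emeasure lborel (ball z (2 * \<rho>)) \<le> ennreal B"
    using emeasure_lborel_ball_finite[of z "2 * \<rho>"]
    by (auto simp: B_def emeasure_eq_ennreal_measure less_top add_nonneg_pos intro!: ennreal_leI)
  \<comment> \<open>Chosen so that the total error \<open>\<omega> * l * B\<close> equals
    \<open>\<rho> / 2 * \<rho> * (e * h)\<close>, which is at most
    \<open>X * (e * h)\<close>.\<close>
  define \<omega> where "\<omega> = e * (\<rho> / 2 * \<rho>) * c / (r * B)"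
  have \<omega>: "0 < \<omega>" using e v r B by (simp add: \<omega>_def)
  define G where "G p = k (fst p) * \<psi> (snd p)" for p
  define K where "K = {-2 * \<rho>..2 * \<rho>} \<times> cball z (4 * \<rho>)"
  have "continuous_on K (\<lambda>p. k (fst p))" "continuous_on K (\<lambda>p. \<psi> (snd p))"
    by (rule continuous_on_compose2[OF contk[of UNIV]] continuous_on_compose2[OF \<psi>(1)];
        auto intro!: continuous_intros)+
  then have "continuous_on K G" unfolding G_def by (rule continuous_on_mult)
  moreover have "compact K" unfolding K_def by (intro compact_Times) auto
  ultimately have "uniformly_continuous_on K G" by (rule compact_uniformly_continuous)
  then obtain \<delta> where \<delta>: "0 < \<delta>" "\<And>p q. p \<in> K \<Longrightarrow> q \<in> K \<Longrightarrow> dist p q < \<delta> \<Longrightarrow> dist (G p) (G q) < \<omega>"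
    using \<omega> unfolding uniformly_continuous_on_def by metis
  \<comment> \<open>In order, these give \<open>h < r\<close>, \<open>l < \<rho> / 2\<close>,
    \<open>r / c\<^sup>2 * h \<le> e\<close> and \<open>4 * l < \<delta>\<close>. The last one is
    needed since reflection moves both the parameter and the point by \<open>2 * s\<close>.\<close>
  define h0 where "h0 = Min {r, \<rho> / 2 / (r / c), e / (r / c\<^sup>2), \<delta> / 4 / (r / c)}"
  have h0: "0 < h0" using r v e \<delta> by (simp add: h0_def)
  have "eventually (\<lambda>h. h \<in> {0<..<h0}) (at_right (0::real))" by (rule eventually_at_right_real[OF h0])
  then show ?thesis
  proof eventually_elim
    case (elim h)
    then have h: "0 < h" "h < r" and h1: "h < \<rho> / 2 / (r / c)" "h < e / (r / c\<^sup>2)" "h < \<delta> / 4 / (r / c)"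
      by (auto simp: h0_def)
    have rc: "0 < r / c" "0 < r / c\<^sup>2" using r v by auto
    have hl: "r * h / c < \<rho> / 2" "r / c\<^sup>2 * h \<le> e" "4 * (r * h / c) < \<delta>"
      using h1(1)[unfolded pos_less_divide_eq[OF rc(1)]] h1(2)[unfolded pos_less_divide_eq[OF rc(2)]]
        h1(3)[unfolded pos_less_divide_eq[OF rc(1)]] by (auto simp: mult.commute)
    define l where "l = r * h / c"
    have l: "0 < l" using r h v by (simp add: l_def)
    define I where "I = shell A (r - h) r"
    define O' where "O' = shell A r (r + (1 + e) * h)"
    have [measurable]: "I \<in> sets borel" "O' \<in> sets borel" by (auto simp: I_def O'_def shell_borel)
    have [measurable]: "ball z (2 * \<rho>) \<in> sets borel" by simp
    have line: "(\<integral>\<^sup>+\<tau>. ennreal (k \<tau>) * (ennreal (\<psi> (y + \<tau> *\<^sub>R v)) * indicator I (y + \<tau> *\<^sub>R v)) \<partial>lborel)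
      \<le> (\<integral>\<^sup>+\<tau>. ennreal (k \<tau>) * (ennreal (\<psi> (y + \<tau> *\<^sub>R v)) * indicator O' (y + \<tau> *\<^sub>R v)) \<partial>lborel)
        + ennreal \<omega> * ennreal l * indicator (ball z (2 * \<rho>)) y" for y
    proof (cases "\<exists>\<tau>1. k \<tau>1 \<noteq> 0 \<and> \<psi> (y + \<tau>1 *\<^sub>R v) \<noteq> 0 \<and> y + \<tau>1 *\<^sub>R v \<in> I")
      case False
      have "ennreal (k \<tau>) * (ennreal (\<psi> (y + \<tau> *\<^sub>R v)) * indicator I (y + \<tau> *\<^sub>R v)) = 0" for \<tau>
      proof -
        have "k \<tau> = 0 \<or> \<psi> (y + \<tau> *\<^sub>R v) = 0 \<or> y + \<tau> *\<^sub>R v \<notin> I" using False by blast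
        then show ?thesis by (elim disjE) auto
      qed
      then show ?thesis by (simp only: nn_integral_const) simp
    next
      case True
      then obtain \<tau>1 where "k \<tau>1 \<noteq> 0" and \<tau>1': "\<psi> (y + \<tau>1 *\<^sub>R v) \<noteq> 0" "y + \<tau>1 *\<^sub>R v \<in> I"
        by blast
      from \<open>k \<tau>1 \<noteq> 0\<close> have "\<bar>\<tau>1\<bar> < \<rho>" by (cases "\<bar>\<tau>1\<bar> < \<rho>") (auto simp: k_def)
      note \<tau>1 = this \<tau>1'
      then have "y + \<tau>1 *\<^sub>R v \<in> ball z \<rho>" using \<psi>(3) by blast
      then have y: "y \<in> ball z (2 * \<rho>)"
        using \<tau>1(1) v dist_triangle[of z y "y + \<tau>1 *\<^sub>R v"] by (simp add: dist_norm)
      obtain \<tau>0 where \<tau>0: "\<bar>\<tau>0\<bar> < 2 * \<rho>"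
        "\<And>\<tau>. \<bar>\<tau>\<bar> < \<rho> \<Longrightarrow> y + \<tau> *\<^sub>R v \<in> I \<Longrightarrow> 0 \<le> \<tau>0 - \<tau> \<and> \<tau>0 - \<tau> \<le> l \<and> y + (\<tau>0 + (\<tau>0 - \<tau>)) *\<^sub>R v \<in> O'"
        using shell_line_reflection[OF dir h hl(1,2) e y \<tau>1(1) \<tau>1(3)[unfolded I_def]]
        unfolding I_def O'_def l_def by blast
      have "(\<integral>\<^sup>+\<tau>. ennreal (k \<tau>) * (ennreal (\<psi> (y + \<tau> *\<^sub>R v)) * indicator I (y + \<tau> *\<^sub>R v)) \<partial>lborel)
        \<le> (\<integral>\<^sup>+\<tau>. ennreal (k \<tau>) * (ennreal (\<psi> (y + \<tau> *\<^sub>R v)) * indicator O' (y + \<tau> *\<^sub>R v)) \<partial>lborel)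
          + ennreal \<omega> * ennreal l"
      proof (rule nn_integral_reflect_le[where c = \<tau>0])
        fix s
        show "ennreal (k (\<tau>0 - s)) * (ennreal (\<psi> (y + (\<tau>0 - s) *\<^sub>R v)) * indicator I (y + (\<tau>0 - s) *\<^sub>R v))
          \<le> ennreal (k (\<tau>0 + s)) * (ennreal (\<psi> (y + (\<tau>0 + s) *\<^sub>R v)) * indicator O' (y + (\<tau>0 + s) *\<^sub>R v))
            + ennreal \<omega> * indicator {0..l} s"
        proof (cases "\<bar>\<tau>0 - s\<bar> < \<rho> \<and> y + (\<tau>0 - s) *\<^sub>R v \<in> I")
          case False
          then show ?thesis by (auto simp: k_def indicator_def)
        next
          case True
          then have s: "0 \<le> s" "s \<le> l" and O: "y + (\<tau>0 + s) *\<^sub>R v \<in> O'"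
            using \<tau>0(2)[of "\<tau>0 - s"] by auto
          have in_K: "(\<tau>, y + \<tau> *\<^sub>R v) \<in> K" if "\<bar>\<tau>\<bar> \<le> 2 * \<rho>" for \<tau>
            using that y v dist_triangle[of z "y + \<tau> *\<^sub>R v" y] by (auto simp: K_def dist_norm)
          have "\<bar>\<tau>0 + s\<bar> \<le> 2 * \<rho>" "\<bar>\<tau>0 - s\<bar> \<le> 2 * \<rho>" using True s hl(1) unfolding l_def by auto
          moreover have "dist (\<tau>0 - s, y + (\<tau>0 - s) *\<^sub>R v) (\<tau>0 + s, y + (\<tau>0 + s) *\<^sub>R v) < \<delta>"
          proof -
            have "dist (\<tau>0 - s, y + (\<tau>0 - s) *\<^sub>R v) (\<tau>0 + s, y + (\<tau>0 + s) *\<^sub>R v)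
              \<le> dist (\<tau>0 - s) (\<tau>0 + s) + dist (y + (\<tau>0 - s) *\<^sub>R v) (y + (\<tau>0 + s) *\<^sub>R v)"
              unfolding dist_Pair_Pair by (rule sqrt_sum_squares_le_sum) auto
            also have "dist (y + (\<tau>0 - s) *\<^sub>R v) (y + (\<tau>0 + s) *\<^sub>R v) = norm (((\<tau>0 - s) - (\<tau>0 + s)) *\<^sub>R v)"
              unfolding dist_norm scaleR_left_diff_distrib[of "\<tau>0 - s"] by simp
            also have "\<dots> = 2 * s" using v s by (simp only: norm_scaleR) simp
            also have "dist (\<tau>0 - s) (\<tau>0 + s) + 2 * s = 4 * s" using s by (simp add: dist_real_def)
            also have "\<dots> < \<delta>" using s(2) hl(3) by (simp add: l_def)
            finally show ?thesis .
          qed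
          ultimately have "dist (G (\<tau>0 - s, y + (\<tau>0 - s) *\<^sub>R v)) (G (\<tau>0 + s, y + (\<tau>0 + s) *\<^sub>R v)) < \<omega>"
            by (intro \<delta>(2) in_K)
          then have "k (\<tau>0 - s) * \<psi> (y + (\<tau>0 - s) *\<^sub>R v) \<le> k (\<tau>0 + s) * \<psi> (y + (\<tau>0 + s) *\<^sub>R v) + \<omega>"
            by (simp add: G_def dist_real_def)
          then have "ennreal (k (\<tau>0 - s) * \<psi> (y + (\<tau>0 - s) *\<^sub>R v))
            \<le> ennreal (k (\<tau>0 + s) * \<psi> (y + (\<tau>0 + s) *\<^sub>R v) + \<omega>)"
            by (rule ennreal_leI)
          also have "\<dots> = ennreal (k (\<tau>0 + s) * \<psi> (y + (\<tau>0 + s) *\<^sub>R v)) + ennreal \<omega>"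
            using \<omega> by (intro ennreal_plus mult_nonneg_nonneg k0 \<psi>(2)) auto
          finally show ?thesis using True O s k0 \<psi>(2) by (simp add: ennreal_mult)
        qed
      qed (use l in auto)
      then show ?thesis using y by simp
    qed
    define SI where "SI = (\<integral>\<^sup>+x. ennreal (\<psi> x) * indicator I x \<partial>lborel)"
    define SO where "SO = (\<integral>\<^sup>+x. ennreal (\<psi> x) * indicator O' x \<partial>lborel)"
    have "X * SI = (\<integral>\<^sup>+y. (\<integral>\<^sup>+\<tau>. ennreal (k \<tau>) * (ennreal (\<psi> (y + \<tau> *\<^sub>R v)) * indicator I (y + \<tau> *\<^sub>R v)) \<partial>lborel) \<partial>lborel)"
      unfolding X_def SI_def by (rule nn_integral_lines[symmetric]) measurable
    also have "\<dots> \<le> (\<integral>\<^sup>+y. (\<integral>\<^sup>+\<tau>. ennreal (k \<tau>) * (ennreal (\<psi> (y + \<tau> *\<^sub>R v)) * indicator O' (y + \<tau> *\<^sub>R v)) \<partial>lborel)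
        + ennreal \<omega> * ennreal l * indicator (ball z (2 * \<rho>)) y \<partial>lborel)"
      by (intro nn_integral_mono line)
    also have "\<dots> = (\<integral>\<^sup>+y. (\<integral>\<^sup>+\<tau>. ennreal (k \<tau>) * (ennreal (\<psi> (y + \<tau> *\<^sub>R v)) * indicator O' (y + \<tau> *\<^sub>R v)) \<partial>lborel) \<partial>lborel)
        + (\<integral>\<^sup>+y. ennreal \<omega> * ennreal l * indicator (ball z (2 * \<rho>)) y \<partial>lborel)"
      by (rule nn_integral_add) measurable
    also have "(\<integral>\<^sup>+y. (\<integral>\<^sup>+\<tau>. ennreal (k \<tau>) * (ennreal (\<psi> (y + \<tau> *\<^sub>R v)) * indicator O' (y + \<tau> *\<^sub>R v)) \<partial>lborel) \<partial>lborel) = X * SO"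
      unfolding X_def SO_def by (rule nn_integral_lines) measurable
    also have "(\<integral>\<^sup>+y. ennreal \<omega> * ennreal l * indicator (ball z (2 * \<rho>)) y \<partial>lborel) \<le> ennreal \<omega> * ennreal l * ennreal B"
      using B by (subst nn_integral_cmult_indicator) (auto intro: mult_left_mono)
    also have "\<dots> = ennreal (\<omega> * l * B)" using \<omega> l B by (simp add: ennreal_mult)
    also have "\<omega> * l * B = \<rho> / 2 * \<rho> * (e * h)" using r v B by (simp add: \<omega>_def l_def)
    also have "\<dots> = ennreal (\<rho> / 2 * \<rho>) * ennreal (e * h)" using v e h by (intro ennreal_mult) auto
    also have "\<dots> \<le> X * ennreal (e * h)" using X_lower by (rule mult_right_mono) simp
    finally have "X * SI \<le> X * (SO + ennreal (e * h))" by (simp add: distrib_left add_left_mono)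
    moreover have "X \<noteq> 0" using X_lower v mult_pos_pos[of \<rho> \<rho>] by auto
    moreover have "X < top" using X_upper by (rule le_less_trans) simp
    ultimately have "SI \<le> SO + ennreal (e * h)" by (simp add: ennreal_mult_le_mult_iff)
    then show ?case by (simp add: SI_def SO_def I_def O'_def)
  qed
qed

text \<open>The open set \<open>U\<close> around the critical part contributes at most
  \<open>e * h\<close>. The rest of the frontier is covered by finitely many regular balls, and the
  weighted estimates are summed over a partition of unity.\<close>

lemma shell_le_if_crit_null:
  assumes null: "hausdorff_measure (DIM('a) - 1) ({x. infdist x A = r} \<inter> crit A) = 0" and e: "0 < e"
  shows "eventually (\<lambda>h. measure lborel (shell A (r - h) r)
    \<le> measure lborel (shell A r (r + (1 + e) * h)) + 2 * e * h) (at_right 0)"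
proof -
  obtain U where U: "open U" "{x. infdist x A = r} \<inter> crit A \<subseteq> U"
    and evU: "eventually (\<lambda>h. measure lborel (shell A (r - h) r \<inter> U) \<le> e * h) (at_right 0)"
    using shell_near_null[OF compact nonempty r compact_frontier_crit[OF compact nonempty] null e] by blast
  define S where "S = {x. infdist x A = r} - U"
  have bdd: "bounded {x. infdist x A \<le> r}"
    by (rule bounded_subset[OF bounded_parallel_set[OF compact_imp_bounded[OF compact] nonempty, of "r + 1"]])
      (auto simp: parallel_set_def)
  have "closed S" unfolding S_def using U by (intro closed_Diff closed_Collect_eq continuous_intros)
  moreover have "bounded S" by (rule bounded_subset[OF bdd]) (auto simp: S_def)
  ultimately have cS: "compact S" by (simp add: compact_eq_bounded_closed)
  have "\<forall>z\<in>S. \<exists>v c \<rho>. regular_direction A z \<rho> v c"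
  proof
    fix z assume "z \<in> S"
    then have "z \<notin> crit A" using U by (auto simp: S_def)
    then show "\<exists>v c \<rho>. regular_direction A z \<rho> v c" by (rule not_crit_direction[OF compact nonempty])
  qed
  then obtain v c \<rho> where dir: "\<And>z. z \<in> S \<Longrightarrow> regular_direction A z (\<rho> z) (v z) (c z)"
    by metis
  then have \<rho>: "0 < \<rho> z" if "z \<in> S" for z using that by (simp add: regular_direction_def)
  have "S \<subseteq> (\<Union>z\<in>S. ball z (\<rho> z))" using \<rho> by force
  then obtain Z where Z: "Z \<subseteq> S" "finite Z" "S \<subseteq> (\<Union>z\<in>Z. ball z (\<rho> z))"
    by (rule compactE_image[OF cS, rotated]) auto
  define t where "t z x = max 0 (\<rho> z - dist z x)" for z x
  define s where "s x = (\<Sum>z\<in>Z. t z x)" for x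
  have conts: "continuous_on T s" for T
    unfolding s_def t_def by (intro continuous_intros)
  have t0: "0 \<le> t z x" for z x by (simp add: t_def)
  have s0: "0 \<le> s x" for x unfolding s_def by (intro sum_nonneg t0)
  have "0 < s x" if xS: "x \<in> S" for x
  proof -
    obtain z where z: "z \<in> Z" "x \<in> ball z (\<rho> z)" using xS Z(3) by blast
    then have "0 < t z x" by (simp add: t_def)
    then show ?thesis unfolding s_def using z Z(2) t0 by (intro sum_pos2[of Z z]) auto
  qed
  then have "\<exists>m>0. \<forall>x\<in>S. m \<le> s x"
    using exists_pos_lower_bound_compact[OF cS conts] by simp
  then obtain m where m: "0 < m" "\<And>x. x \<in> S \<Longrightarrow> m \<le> s x" by auto
  \<comment> \<open>The lower cutoff \<open>m / 2\<close> makes the functions continuous everywhere.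
    Their sum is at most 1, and equals 1 on the neighbourhood \<open>W\<close> of
    \<open>S\<close>.\<close>
  define \<psi> where "\<psi> z x = t z x / max (s x) (m / 2)" for z x
  have mx: "0 < max (s x) (m / 2)" for x using m by (simp add: less_max_iff_disj)
  have \<psi>_cont: "continuous_on UNIV (\<psi> z)" for z
    unfolding \<psi>_def
  proof (rule continuous_on_divide)
    show "continuous_on UNIV (t z)" unfolding t_def by (intro continuous_intros)
    show "continuous_on UNIV (\<lambda>x. max (s x) (m / 2))" by (intro continuous_on_max conts continuous_on_const)
    show "\<forall>x\<in>UNIV. max (s x) (m / 2) \<noteq> 0" using mx by (metis less_irrefl)
  qed
  have \<psi>0: "0 \<le> \<psi> z x" for z x using t0 mx[of x] by (simp add: \<psi>_def)
  have \<psi>_sum: "(\<Sum>z\<in>Z. \<psi> z x) = s x / max (s x) (m / 2)" for x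
    by (simp add: \<psi>_def s_def sum_divide_distrib)
  define W where "W = {x. m / 2 < s x}"
  have W: "open W" unfolding W_def by (intro open_Collect_less continuous_intros conts)
  define e' where "e' = e / (real (card Z) + 1)"
  have e': "0 < e'" using e by (simp add: e'_def add_nonneg_pos)
  have "e' \<le> e" using e by (simp add: e'_def field_simps)
  have ev\<psi>: "eventually (\<lambda>h. \<forall>z\<in>Z. (\<integral>\<^sup>+x. ennreal (\<psi> z x) * indicator (shell A (r - h) r) x \<partial>lborel)
    \<le> (\<integral>\<^sup>+x. ennreal (\<psi> z x) * indicator (shell A r (r + (1 + e') * h)) x \<partial>lborel) + ennreal (e' * h)) (at_right 0)"
  proof (rule eventually_ball_finite[OF Z(2)], intro ballI)
    fix z assume "z \<in> Z"
    then have z: "z \<in> S" using Z by auto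
    show "eventually (\<lambda>h. (\<integral>\<^sup>+x. ennreal (\<psi> z x) * indicator (shell A (r - h) r) x \<partial>lborel)
    \<le> (\<integral>\<^sup>+x. ennreal (\<psi> z x) * indicator (shell A r (r + (1 + e') * h)) x \<partial>lborel) + ennreal (e' * h)) (at_right 0)"
      by (rule shell_weighted_regular[OF dir[OF z] \<psi>_cont \<psi>0 _ e'])
        (auto simp: \<psi>_def t_def)
  qed
  \<comment> \<open>Points of distance at most \<open>r\<close> outside \<open>U \<union> W\<close>
    form a compact set missing the level \<open>r\<close>, so thin inner shells avoid it.\<close>
  obtain h0 where h0: "0 < h0" "\<And>h. 0 < h \<Longrightarrow> h < h0 \<Longrightarrow> shell A (r - h) r \<subseteq> U \<union> W"
  proof -
    define Q where "Q = {x. infdist x A \<le> r} - U - W"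
    have "closed Q" unfolding Q_def using U W by (intro closed_Diff closed_Collect_le continuous_intros)
    moreover have "bounded Q" by (rule bounded_subset[OF bdd]) (auto simp: Q_def)
    ultimately have cQ: "compact Q" by (simp add: compact_eq_bounded_closed)
    have "0 < r - infdist x A" if "x \<in> Q" for x
    proof -
      have "x \<notin> S" using that m by (force simp: Q_def W_def)
      then show ?thesis using that by (auto simp: Q_def S_def less_le)
    qed
    moreover have "continuous_on Q (\<lambda>x. r - infdist x A)" by (intro continuous_intros)
    ultimately have "\<exists>m>0. \<forall>x\<in>Q. m \<le> r - infdist x A"
      using exists_pos_lower_bound_compact[OF cQ] by simp
    then obtain h0 where h0: "0 < h0" "\<forall>x\<in>Q. h0 \<le> r - infdist x A" by auto
    show thesis
    proof (rule that[OF h0(1)], rule subsetI)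
      fix h x assume "0 < h" "h < h0" "x \<in> shell A (r - h) r"
      then have "x \<notin> Q" "infdist x A \<le> r" using h0(2) by (auto simp: shell_def)
      then show "x \<in> U \<union> W" by (simp add: Q_def)
    qed
  qed
  have "eventually (\<lambda>h. h \<in> {0<..<h0}) (at_right (0::real))" by (rule eventually_at_right_real[OF h0(1)])
  with evU ev\<psi> show ?thesis
  proof eventually_elim
    case (elim h)
    then have h: "0 < h" "h < h0" by auto
    define I where "I = shell A (r - h) r"
    define O' where "O' = shell A r (r + (1 + e') * h)"
    note shell_borel [measurable]
    have [measurable]: "\<psi> z \<in> borel_measurable borel" for z by (rule borel_measurable_continuous_onI[OF \<psi>_cont])
    have Im [measurable]: "I \<in> sets borel" "O' \<in> sets borel" by (auto simp: I_def O'_def shell_borel)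
    have If: "I \<in> fmeasurable lborel" "O' \<in> fmeasurable lborel"
      unfolding I_def O'_def by (rule shell_fmeasurable[OF compact nonempty])+
    have Wm: "W \<in> sets borel" "U \<in> sets borel" using W U by auto
    have IW: "I \<inter> W \<in> fmeasurable lborel" and IU: "I \<inter> U \<in> fmeasurable lborel"
      using If Wm by (auto intro!: fmeasurable_Int_fmeasurable)
    have "emeasure lborel (I \<inter> W) = (\<integral>\<^sup>+x. indicator (I \<inter> W) x \<partial>lborel)"
      using Wm Im by (subst nn_integral_indicator) auto
    also have "\<dots> \<le> (\<integral>\<^sup>+x. (\<Sum>z\<in>Z. ennreal (\<psi> z x) * indicator I x) \<partial>lborel)"
    proof (rule nn_integral_mono)
      fix x
      show "indicator (I \<inter> W) x \<le> (\<Sum>z\<in>Z. ennreal (\<psi> z x) * indicator I x)"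
      proof (cases "x \<in> I \<inter> W")
        case True
        then have "(\<Sum>z\<in>Z. \<psi> z x) = 1" using m unfolding \<psi>_sum by (auto simp: W_def max_def)
        then show ?thesis using True \<psi>0 by (simp flip: sum_distrib_right)
      qed simp
    qed
    also have "\<dots> = (\<Sum>z\<in>Z. \<integral>\<^sup>+x. ennreal (\<psi> z x) * indicator I x \<partial>lborel)"
      by (rule nn_integral_sum) measurable
    also have "\<dots> \<le> (\<Sum>z\<in>Z. (\<integral>\<^sup>+x. ennreal (\<psi> z x) * indicator O' x \<partial>lborel) + ennreal (e' * h))"
      using elim(2) unfolding I_def O'_def by (intro sum_mono) auto
    also have "\<dots> = (\<integral>\<^sup>+x. (\<Sum>z\<in>Z. ennreal (\<psi> z x) * indicator O' x) \<partial>lborel) + ennreal (real (card Z) * (e' * h))"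
    proof -
      have "(\<Sum>z\<in>Z. ennreal (e' * h)) = ennreal (real (card Z) * (e' * h))"
        using e' h by (subst sum_ennreal) auto
      then show ?thesis by (simp add: nn_integral_sum sum.distrib)
    qed
    also have "(\<integral>\<^sup>+x. (\<Sum>z\<in>Z. ennreal (\<psi> z x) * indicator O' x) \<partial>lborel) \<le> (\<integral>\<^sup>+x. indicator O' x \<partial>lborel)"
    proof (rule nn_integral_mono)
      fix x
      have "(\<Sum>z\<in>Z. \<psi> z x) \<le> 1" unfolding \<psi>_sum using mx[of x] by (simp add: divide_le_eq_1)
      then show "(\<Sum>z\<in>Z. ennreal (\<psi> z x) * indicator O' x) \<le> indicator O' x"
        using \<psi>0 by (auto simp: indicator_def)
    qed
    also have "(\<integral>\<^sup>+x. indicator O' x \<partial>lborel) = emeasure lborel O'" using Im by simp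
    finally have "emeasure lborel (I \<inter> W) \<le> emeasure lborel O' + ennreal (real (card Z) * (e' * h))"
      by (simp add: add_right_mono)
    also have "\<dots> = ennreal (measure lborel O' + real (card Z) * (e' * h))"
      using If e' h by (simp add: emeasure_eq_measure2)
    finally have "measure lborel (I \<inter> W) \<le> measure lborel O' + real (card Z) * (e' * h)"
      unfolding emeasure_eq_measure2[OF IW] using e' h by (subst (asm) ennreal_le_iff) auto
    moreover have "real (card Z) * (e' * h) \<le> e * h"
    proof -
      have "real (card Z) * e' \<le> e" using e by (simp add: e'_def field_simps)
      then show ?thesis using h mult_right_mono[of "real (card Z) * e'" e h] by (simp add: mult_ac)
    qed
    moreover have "measure lborel I \<le> measure lborel (I \<inter> U) + measure lborel (I \<inter> W)"
    proof -
      have "I = (I \<inter> U) \<union> (I \<inter> W)" using h0(2)[OF h] by (auto simp: I_def)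
      then show ?thesis using measure_Un_le[of "I \<inter> U" lborel "I \<inter> W"] fmeasurableD[OF IU] fmeasurableD[OF IW] by simp
    qed
    moreover have "measure lborel O' \<le> measure lborel (shell A r (r + (1 + e) * h))"
    proof -
      have "(1 + e') * h \<le> (1 + e) * h" using \<open>e' \<le> e\<close> h by (intro mult_right_mono) auto
      then show ?thesis
        unfolding O'_def by (intro measure_mono_fmeasurable shell_fmeasurable[OF compact nonempty])
         (auto simp: shell_def intro: shell_borel[unfolded shell_def])
    qed
    ultimately show ?case using elim(1) unfolding I_def by linarith
  qed
qed

text \<open>The widening of the outer shell by \<open>e' * h\<close> costs at most
  \<open>L * (e' * h)\<close> by the Lipschitz bound.\<close>

lemma differentiable_if_crit_null:
  assumes null: "hausdorff_measure (DIM('a) - 1) ({x. infdist x A = r} \<inter> crit A) = 0"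
  shows "volume_function A differentiable (at r)"
proof (rule volume_function_differentiable_if[OF compact nonempty r])
  fix e :: real assume e: "0 < e"
  obtain L where L: "0 < L" "\<And>t h. r / 2 \<le> t \<Longrightarrow> t \<le> 2 * r \<Longrightarrow> 0 < h \<Longrightarrow> h \<le> r / 8 \<Longrightarrow>
    volume_function A t - volume_function A (t - h) \<le> L * h"
    by (rule volume_function_locally_Lipschitz[OF compact nonempty r]) blast
  \<comment> \<open>Makes the widening and the error \<open>2 * e' * h\<close> together at most
    \<open>e * h\<close>.\<close>
  define e' where "e' = min 1 (e / (L + 2))"
  have "e' \<le> e / (L + 2)" by (simp add: e'_def)
  then have "e' * (L + 2) \<le> e" using L by (simp add: pos_le_divide_eq)
  moreover have "0 < e'" "e' \<le> 1" using e L by (auto simp: e'_def)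
  ultimately have e': "0 < e'" "e' \<le> 1" "e' * (L + 2) \<le> e" by auto
  have "eventually (\<lambda>h. h \<in> {0<..<r / 8}) (at_right (0::real))" using r by (intro eventually_at_right_real) auto
  with shell_le_if_crit_null[OF null e'(1)]
  show "eventually (\<lambda>h. volume_function A r - volume_function A (r - h)
      \<le> volume_function A (r + h) - volume_function A r + e * h) (at_right 0)"
  proof eventually_elim
    case (elim h)
    then have h: "0 < h" "h < r / 8" by auto
    have "e' * h \<le> 1 * h" using e' h by (intro mult_right_mono) auto
    then have "e' * h \<le> r / 8" using h by linarith
    moreover have "0 < e' * h" using e' h by simp
    ultimately have eh: "0 < e' * h" "e' * h \<le> r / 8" by auto
    have "r + (1 + e') * h - e' * h = r + h" by (simp add: algebra_simps)
    then have "volume_function A (r + (1 + e') * h) - volume_function A (r + h) \<le> L * (e' * h)"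
      using L(2)[of "r + (1 + e') * h" "e' * h"] eh h r by (simp add: algebra_simps)
    moreover have "measure lborel (shell A (r - h) r) = volume_function A r - volume_function A (r - h)"
      "measure lborel (shell A r (r + (1 + e') * h)) = volume_function A (r + (1 + e') * h) - volume_function A r"
      using h e' by (subst volume_function_diff[OF compact nonempty]; simp)+
    moreover have "L * (e' * h) + 2 * e' * h \<le> e * h"
      using mult_right_mono[OF e'(3), of h] h by (simp add: algebra_simps)
    ultimately show ?case using elim(1) by linarith
  qed
qed

text \<open>For an exterior witness \<open>y\<close> of \<open>z\<close>, any nearest point
  \<open>a\<close> of \<open>z\<close> turns the triangle inequality for \<open>y\<close>,
  \<open>z\<close>, \<open>a\<close> into an equality. Hence \<open>a\<close> lies on the ray from
  \<open>y\<close> through \<open>z\<close> at distance \<open>r\<close> beyond \<open>z\<close>,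
  which determines it.\<close>

lemma positive_boundary_subset_Unp: "positive_boundary (parallel_set A r) \<subseteq> Unp A"
proof
  fix z assume z: "z \<in> positive_boundary (parallel_set A r)"
  then have iz: "infdist z A = r"
    using frontier_parallel_set[OF compact nonempty r] by (auto simp: positive_boundary_def)
  from z obtain y where y: "y \<notin> closure (parallel_set A r)" "dist y z = infdist y (parallel_set A r)"
    by (auto simp: positive_boundary_def)
  have ry: "r < infdist y A" using y closure_parallel_set[OF compact nonempty r] by auto
  have far: "infdist y A \<le> dist y z + r"
    using infdist_triangle[of y A z] iz by simp
  have le: "dist y z \<le> infdist y A - r"
  proof (rule field_le_epsilon)
    fix e :: real assume e: "0 < e"
    obtain w where w: "w \<in> parallel_set A r" "dist y w \<le> infdist y A - r + e"
    proof -
      \<comment> \<open>Contracts \<open>y\<close> to level \<open>r - e\<close>, or to level 0 if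
        that is negative, giving points of the parallel set nearly as close to \<open>y\<close> as
        the level \<open>r\<close>.\<close>
      define \<theta> where "\<theta> = max 0 (r - e) / infdist y A"
      have i0: "0 < infdist y A" using ry r by simp
      have \<theta>: "0 \<le> \<theta>" "\<theta> \<le> 1" "\<theta> * infdist y A = max 0 (r - e)"
        using i0 ry e r by (auto simp: \<theta>_def divide_le_eq_1)
      show thesis
      proof (rule that[of "contract A \<theta> y"])
        show "contract A \<theta> y \<in> parallel_set A r"
          using infdist_contract(1)[OF compact nonempty \<theta>(1,2), of y] \<theta>(3) e r by (simp add: parallel_set_def)
        show "dist y (contract A \<theta> y) \<le> infdist y A - r + e"
          using infdist_contract(2)[OF compact nonempty \<theta>(1,2), of y] \<theta>(3) by (simp add: left_diff_distrib)
      qed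
    qed
    show "dist y z \<le> infdist y A - r + e"
      using infdist_le[OF w(1), of y] w(2) y(2) by simp
  qed
  have "a = z - (r / (infdist y A - r)) *\<^sub>R (y - z)" if a: "a \<in> nearest_points A z" for a
  proof -
    have za: "dist z a = r" and aA: "a \<in> A" using nearest_pointsD[OF a] iz by auto
    have yz: "dist y z = infdist y A - r" using le far by simp
    have "dist y a = dist y z + dist z a"
      using infdist_le[OF aA, of y] dist_triangle[of y a z] za yz by simp
    then have "norm (y - z) *\<^sub>R (z - a) = norm (z - a) *\<^sub>R (y - z)"
      by (simp only: dist_triangle_eq)
    then have eq: "(infdist y A - r) *\<^sub>R (z - a) = r *\<^sub>R (y - z)"
      using za yz by (simp only: dist_norm)
    have "z - a = (1 / (infdist y A - r)) *\<^sub>R ((infdist y A - r) *\<^sub>R (z - a))" using ry by simp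
    also have "\<dots> = (r / (infdist y A - r)) *\<^sub>R (y - z)" unfolding eq by simp
    finally show ?thesis by (metis diff_diff_eq2 add_diff_cancel_left')
  qed
  then show "z \<in> Unp A"
    using proj_nearest[OF compact nonempty, of z] unfolding Unp_def by blast
qed

text \<open>With a single nearest point the convex hull is that point, so a critical
  \<open>z\<close> would lie in \<open>A\<close>.\<close>

lemma crit_disjoint_Unp:
  assumes "infdist z A = r" "z \<in> crit A"
  shows "z \<notin> Unp A"
proof
  assume "z \<in> Unp A"
  then obtain a where a: "a \<in> nearest_points A z" "\<And>b. b \<in> nearest_points A z \<Longrightarrow> b = a"
    by (auto simp: Unp_def)
  then have "nearest_points A z = {a}" by blast
  then have "z = a" using assms(2) by (simp add: crit_def)
  then show False using nearest_pointsD(2)[OF a(1)] assms(1) r by simp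
qed

end

section \<open>Assembling the equivalences\<close>

lemma hausdorff_measure_mono:
  assumes "S \<subseteq> T" shows "hausdorff_measure m S \<le> hausdorff_measure m T"
  unfolding hausdorff_measure_def hausdorff_premeasure_def
  using assms by (intro SUP_mono' INF_superset_mono) auto

theorem theorem3p2:
  fixes A :: "'a::euclidean_space set" and r :: real
  assumes "compact A" and "A \<noteq> {}" and "r > 0"
  defines "i \<equiv> volume_function A differentiable (at r)"
    and "ii \<equiv> hausdorff_measure (DIM('a) - 1)
                (frontier (parallel_set A r) - positive_boundary (parallel_set A r)) = 0"
    and "iii \<equiv> hausdorff_measure (DIM('a) - 1) (frontier (parallel_set A r) - Unp A) = 0 \<and>
                hausdorff_measure (DIM('a) - 1)
                  ((frontier (parallel_set A r) \<inter> Unp A) - positive_boundary (parallel_set A r)) = 0"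
    and "iv \<equiv> hausdorff_measure (DIM('a) - 1) (frontier (parallel_set A r) - Unp A) = 0"
    and "v \<equiv> hausdorff_measure (DIM('a) - 1) (frontier (parallel_set A r) \<inter> crit A) = 0"
  shows "(i \<longleftrightarrow> ii) \<and> (i \<longleftrightarrow> iii) \<and> (i \<longleftrightarrow> iv) \<and> (i \<longleftrightarrow> v)"
proof -
  note A = assms(1-3)
  note fr = frontier_parallel_set[OF A]
  have null_mono: "hausdorff_measure m S = 0" if "hausdorff_measure m T = 0" "S \<subseteq> T" for m and S T :: "'a set"
    using hausdorff_measure_mono[OF that(2), of m] that(1) by simp
  \<comment> \<open>The implications form a cycle. The first and the last carry the analysis; those
    between follow from inclusions of sets or by dropping a conjunct.\<close>
  have "i \<Longrightarrow> ii"
    unfolding i_def ii_def by (rule differentiable_imp_positive_boundary_full[OF A])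
  moreover have "ii \<Longrightarrow> iii"
    unfolding ii_def iii_def using positive_boundary_subset_Unp[OF A] by (auto elim!: null_mono)
  moreover have "iii \<Longrightarrow> iv" unfolding iii_def iv_def by simp
  moreover have "iv \<Longrightarrow> v"
    unfolding iv_def v_def using crit_disjoint_Unp[OF A] by (elim null_mono) (auto simp: fr)
  moreover have "v \<Longrightarrow> i"
    unfolding v_def i_def fr by (rule differentiable_if_crit_null[OF A])
  ultimately show ?thesis by blast
qed

end
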